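(* Let $M$ be a connected oriented Riemannian 2-manifold (viewed as a Riemann surface) with Gauss curvature $K$, and let $X$ be a unit norm vector field of class $\mathrm{C}^2$ on $M$. Let $Y$ be the vector field such that $(X,Y)$ is a direct orthonormal frame, and put $A_0=\langle\nabla_XX,Y\rangle$, $A_1=\langle\nabla_YX,Y\rangle$, $A=A_1+\sqrt{-1}\,A_0$. Suppose that $X$ is a solution of $$2(1+|A|^2)\frac{\partial A}{\partial\overline z}-A\,\frac{\partial |A|^2}{\partial\overline z}=0$$ (in conformal charts $z$ of $M$), such that the function $|A|$ is constant. Then $A$ is constant and $M$ has constant sectional curvature $K=-|A|^2\leq 0$. In particular, $$\mathrm{vol}(X)=\sqrt{1-K}\;\mathrm{vol}(M).$$
   Context: $\nabla$ is the Levi-Civita connection of the metric $\langle\cdot,\cdot\rangle$ of $M$. The volume of a unit vector field $X$ is the volume of $M$ for the pullback by $X:M\to SM$ of the Sasaki metric on the unit tangent bundle, i.e. $\mathrm{vol}(X)=\int_M\sqrt{1+\|\nabla_{e_0}X\|^2+\|\nabla_{e_1}X\|^2}\,\mathrm{vol}_M$ for any local orthonormal frame $e_0,e_1$ of $M$. $\mathrm{vol}(M)$ is the Riemannian area of $M$. Conformal charts are taken compatible with the orientation. *)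

theory Defs
  imports "HOL-Analysis.Analysis" "HOL-Complex_Analysis.Complex_Analysis"
begin

section \<open>Differentiability in the plane\<close>

definition partial :: "2 \<Rightarrow> (real^2 \<Rightarrow> 'b::real_normed_vector) \<Rightarrow> real^2 \<Rightarrow> 'b" where
  "partial i f x = frechet_derivative f (at x) (axis i 1)"

text \<open>Only used for open \<open>S\<close>.\<close>

primrec Ck_on :: "nat \<Rightarrow> (real^2) set \<Rightarrow> (real^2 \<Rightarrow> 'b::real_normed_vector) \<Rightarrow> bool" where
  "Ck_on 0 S f \<longleftrightarrow> continuous_on S f"
| "Ck_on (Suc k) S f \<longleftrightarrow> (\<forall>x\<in>S. f differentiable (at x)) \<and> (\<forall>i. Ck_on k S (partial i f))"

definition smooth_on :: "(real^2) set \<Rightarrow> (real^2 \<Rightarrow> 'b::real_normed_vector) \<Rightarrow> bool" where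
  "smooth_on S f \<longleftrightarrow> (\<forall>k. Ck_on k S f)"


section \<open>Oriented surfaces\<close>

text \<open>
  The underlying set of a surface is a whole type \<open>'a\<close> of class \<open>t2_space\<close> and
  \<open>second_countable_topology\<close>. A chart is a pair of an open domain and a coordinate map;
  the values of the coordinate map outside the domain are irrelevant.
\<close>

type_synonym 'a chart = "'a set \<times> ('a \<Rightarrow> real^2)"

abbreviation dom_of :: "'a chart \<Rightarrow> 'a set" where "dom_of c \<equiv> fst c"
abbreviation coord :: "'a chart \<Rightarrow> 'a \<Rightarrow> real^2" where "coord c \<equiv> snd c"

definition param :: "'a chart \<Rightarrow> real^2 \<Rightarrow> 'a" where
  "param c = inv_into (dom_of c) (coord c)"

definition is_chart :: "'a::topological_space chart \<Rightarrow> bool" where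
  "is_chart c \<longleftrightarrow> open (dom_of c) \<and> open (coord c ` dom_of c) \<and>
     homeomorphism (dom_of c) (coord c ` dom_of c) (coord c) (param c)"

definition transition :: "'a chart \<Rightarrow> 'a chart \<Rightarrow> real^2 \<Rightarrow> real^2" where
  "transition c d = coord d \<circ> param c"

definition transition_dom :: "'a chart \<Rightarrow> 'a chart \<Rightarrow> (real^2) set" where
  "transition_dom c d = coord c ` (dom_of c \<inter> dom_of d)"

definition jac :: "'a chart \<Rightarrow> 'a chart \<Rightarrow> 'a \<Rightarrow> real^2^2" where
  "jac c d p = jacobian (transition c d) (at (coord c p))"

definition compatible :: "'a chart \<Rightarrow> 'a chart \<Rightarrow> bool" where
  "compatible c d \<longleftrightarrow>
     smooth_on (transition_dom c d) (transition c d) \<and>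
     smooth_on (transition_dom d c) (transition d c) \<and>
     (\<forall>p\<in>dom_of c \<inter> dom_of d. det (jac c d p) > 0)"

text \<open>A smooth structure with an orientation, given as a maximal oriented atlas.\<close>

definition oriented_surface :: "'a::{t2_space,second_countable_topology} chart set \<Rightarrow> bool" where
  "oriented_surface \<A> \<longleftrightarrow>
     (\<forall>c\<in>\<A>. is_chart c) \<and>
     (\<Union>c\<in>\<A>. dom_of c) = UNIV \<and>
     (\<forall>c\<in>\<A>. \<forall>d\<in>\<A>. compatible c d) \<and>
     (\<forall>c. is_chart c \<and> (\<forall>d\<in>\<A>. compatible c d) \<longrightarrow> c \<in> \<A>)"

text \<open>
  Quantities that do not depend on the chart are evaluated at \<open>p\<close> in an arbitrary chart
  around \<open>p\<close>.
\<close>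

definition chart_at :: "'a chart set \<Rightarrow> 'a \<Rightarrow> 'a chart" where
  "chart_at \<A> p = (SOME c. c \<in> \<A> \<and> p \<in> dom_of c)"

text \<open>The partial derivative of a function on the surface in a chart.\<close>

definition pd :: "'a chart \<Rightarrow> 2 \<Rightarrow> ('a \<Rightarrow> 'b::real_normed_vector) \<Rightarrow> 'a \<Rightarrow> 'b" where
  "pd c i f p = partial i (f \<circ> param c) (coord c p)"


section \<open>Vector fields and Riemannian metrics\<close>

text \<open>
  A vector field is given by its components in each chart of the atlas, a metric by its Gram
  matrix in each chart; both are subject to the transformation law of the respective tensors.
\<close>

type_synonym 'a vfield = "'a chart \<Rightarrow> 'a \<Rightarrow> real^2"
type_synonym 'a gram = "'a chart \<Rightarrow> 'a \<Rightarrow> real^2^2"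

definition vector_field :: "'a chart set \<Rightarrow> 'a vfield \<Rightarrow> bool" where
  "vector_field \<A> X \<longleftrightarrow>
     (\<forall>c\<in>\<A>. \<forall>d\<in>\<A>. \<forall>p\<in>dom_of c \<inter> dom_of d. X d p = jac c d p *v X c p)"

definition Ck_vector_field :: "nat \<Rightarrow> 'a chart set \<Rightarrow> 'a vfield \<Rightarrow> bool" where
  "Ck_vector_field k \<A> X \<longleftrightarrow>
     vector_field \<A> X \<and> (\<forall>c\<in>\<A>. Ck_on k (coord c ` dom_of c) (X c \<circ> param c))"

definition riemannian_metric :: "'a chart set \<Rightarrow> 'a gram \<Rightarrow> bool" where
  "riemannian_metric \<A> g \<longleftrightarrow>
     (\<forall>c\<in>\<A>. smooth_on (coord c ` dom_of c) (g c \<circ> param c)) \<and>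
     (\<forall>c\<in>\<A>. \<forall>p\<in>dom_of c. transpose (g c p) = g c p \<and> (\<forall>v. v \<noteq> 0 \<longrightarrow> v \<bullet> (g c p *v v) > 0)) \<and>
     (\<forall>c\<in>\<A>. \<forall>d\<in>\<A>. \<forall>p\<in>dom_of c \<inter> dom_of d.
        g c p = transpose (jac c d p) ** g d p ** jac c d p)"

definition metric_in :: "'a gram \<Rightarrow> 'a chart \<Rightarrow> 'a \<Rightarrow> real^2 \<Rightarrow> real^2 \<Rightarrow> real" where
  "metric_in g c p v w = v \<bullet> (g c p *v w)"

definition riem_inner :: "'a chart set \<Rightarrow> 'a gram \<Rightarrow> 'a vfield \<Rightarrow> 'a vfield \<Rightarrow> 'a \<Rightarrow> real" where
  "riem_inner \<A> g V W p = (let c = chart_at \<A> p in metric_in g c p (V c p) (W c p))"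

definition unit_vector_field :: "'a chart set \<Rightarrow> 'a gram \<Rightarrow> 'a vfield \<Rightarrow> bool" where
  "unit_vector_field \<A> g X \<longleftrightarrow> vector_field \<A> X \<and> (\<forall>p. riem_inner \<A> g X X p = 1)"

definition direct_orthonormal_frame ::
  "'a chart set \<Rightarrow> 'a gram \<Rightarrow> 'a vfield \<Rightarrow> 'a vfield \<Rightarrow> bool" where
  "direct_orthonormal_frame \<A> g X Y \<longleftrightarrow>
     vector_field \<A> X \<and> vector_field \<A> Y \<and>
     (\<forall>p. riem_inner \<A> g X X p = 1 \<and> riem_inner \<A> g X Y p = 0 \<and> riem_inner \<A> g Y Y p = 1) \<and>
     (\<forall>c\<in>\<A>. \<forall>p\<in>dom_of c. det (vector [X c p, Y c p] :: real^2^2) > 0)"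


section \<open>Levi-Civita connection and curvature\<close>

text \<open>\<open>christoffel g c k i j\<close> is the symbol with upper index \<open>k\<close> and lower indices \<open>i\<close>, \<open>j\<close>.\<close>

definition christoffel :: "'a gram \<Rightarrow> 'a chart \<Rightarrow> 2 \<Rightarrow> 2 \<Rightarrow> 2 \<Rightarrow> 'a \<Rightarrow> real" where
  "christoffel g c k i j p =
     (\<Sum>l\<in>UNIV. matrix_inv (g c p) $ k $ l *
        (pd c i (\<lambda>q. g c q $ j $ l) p + pd c j (\<lambda>q. g c q $ i $ l) p
           - pd c l (\<lambda>q. g c q $ i $ j) p)) / 2"

text \<open>The covariant derivative of the field \<open>X\<close> along the tangent vector \<open>v\<close> at \<open>p\<close>, in a chart.\<close>

definition nabla_in :: "'a gram \<Rightarrow> 'a chart \<Rightarrow> 'a \<Rightarrow> real^2 \<Rightarrow> 'a vfield \<Rightarrow> real^2" where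
  "nabla_in g c p v X = (\<chi> k. \<Sum>i\<in>UNIV. v $ i *
     (pd c i (\<lambda>q. X c q $ k) p + (\<Sum>j\<in>UNIV. christoffel g c k i j p * X c p $ j)))"

definition nabla :: "'a gram \<Rightarrow> 'a vfield \<Rightarrow> 'a vfield \<Rightarrow> 'a vfield" where
  "nabla g V X = (\<lambda>c p. nabla_in g c p (V c p) X)"

text \<open>
  \<open>riemann g c l k i j\<close> is the component \<open>l\<close> of \<open>R(\<partial>\<^sub>i,\<partial>\<^sub>j)\<partial>\<^sub>k\<close>, where
  \<open>R(U,V)W = \<nabla>\<^sub>U \<nabla>\<^sub>V W - \<nabla>\<^sub>V \<nabla>\<^sub>U W - \<nabla>\<^bsub>[U,V]\<^esub> W\<close>.
\<close>

definition riemann :: "'a gram \<Rightarrow> 'a chart \<Rightarrow> 2 \<Rightarrow> 2 \<Rightarrow> 2 \<Rightarrow> 2 \<Rightarrow> 'a \<Rightarrow> real" where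
  "riemann g c l k i j p =
     pd c i (christoffel g c l j k) p - pd c j (christoffel g c l i k) p +
     (\<Sum>m\<in>UNIV. christoffel g c l i m p * christoffel g c m j k p
              - christoffel g c l j m p * christoffel g c m i k p)"

text \<open>
  The sectional curvature of the tangent plane at \<open>p\<close>:
  \<open>\<langle>R(\<partial>\<^sub>1,\<partial>\<^sub>2)\<partial>\<^sub>2, \<partial>\<^sub>1\<rangle>\<close> divided by the squared area of the parallelogram of \<open>\<partial>\<^sub>1\<close>, \<open>\<partial>\<^sub>2\<close>.
\<close>

definition gauss_curvature :: "'a chart set \<Rightarrow> 'a gram \<Rightarrow> 'a \<Rightarrow> real" where
  "gauss_curvature \<A> g p = (let c = chart_at \<A> p in
     metric_in g c p (\<chi> l. riemann g c l 2 1 2 p) (axis 1 1) / det (g c p))"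


section \<open>Area, and volume of a unit vector field\<close>

text \<open>
  The Borel measure which in every chart has density \<open>sqrt (det g)\<close>. It exists by the change of
  variables formula, and is unique because countably many chart domains cover the surface.
\<close>

definition riemannian_measure ::
  "'a::{t2_space,second_countable_topology} chart set \<Rightarrow> 'a gram \<Rightarrow> 'a measure" where
  "riemannian_measure \<A> g = (THE \<mu>. sets \<mu> = sets borel \<and>
     (\<forall>c\<in>\<A>. \<forall>B\<in>sets borel. B \<subseteq> dom_of c \<longrightarrow>
        emeasure \<mu> B =
          (\<integral>\<^sup>+x. ennreal (sqrt (det (g c (param c x)))) * indicator (coord c ` B) x \<partial>lborel)))"

definition vol :: "'a::{t2_space,second_countable_topology} chart set \<Rightarrow> 'a gram \<Rightarrow> ennreal" where
  "vol \<A> g = emeasure (riemannian_measure \<A> g) (space (riemannian_measure \<A> g))"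

text \<open>
  The density of the pullback by \<open>X\<close> of the Sasaki metric. The expression under the root does not
  depend on the orthonormal basis of the tangent plane, so an arbitrary one is used.
\<close>

definition sasaki_density :: "'a chart set \<Rightarrow> 'a gram \<Rightarrow> 'a vfield \<Rightarrow> 'a \<Rightarrow> real" where
  "sasaki_density \<A> g X p = (let
     c = chart_at \<A> p;
     (e0, e1) = (SOME (u, v). metric_in g c p u u = 1 \<and> metric_in g c p u v = 0 \<and>
                              metric_in g c p v v = 1);
     normsq = (\<lambda>w. metric_in g c p w w)
   in sqrt (1 + normsq (nabla_in g c p e0 X) + normsq (nabla_in g c p e1 X)))"

definition vol_field ::
  "'a::{t2_space,second_countable_topology} chart set \<Rightarrow> 'a gram \<Rightarrow> 'a vfield \<Rightarrow> ennreal" where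
  "vol_field \<A> g X = (\<integral>\<^sup>+p. ennreal (sasaki_density \<A> g X p) \<partial>riemannian_measure \<A> g)"


section \<open>Conformal charts\<close>

text \<open>
  Members of a maximal oriented atlas, hence smooth and compatible with the orientation, in which
  the metric is a positive multiple of the Euclidean one.
\<close>

definition conformal_charts :: "'a chart set \<Rightarrow> 'a gram \<Rightarrow> 'a chart set" where
  "conformal_charts \<A> g = {c\<in>\<A>. \<forall>p\<in>dom_of c. \<exists>r>0. g c p = mat r}"

definition plane_to_complex :: "real^2 \<Rightarrow> complex" where
  "plane_to_complex x = Complex (x $ 1) (x $ 2)"

definition complex_to_plane :: "complex \<Rightarrow> real^2" where
  "complex_to_plane z = vector [Re z, Im z]"

definition riemann_surface :: "'a::{t2_space,second_countable_topology} chart set \<Rightarrow> bool" where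
  "riemann_surface Z \<longleftrightarrow>
     (\<forall>c\<in>Z. is_chart c) \<and> (\<Union>c\<in>Z. dom_of c) = UNIV \<and>
     (\<forall>c\<in>Z. \<forall>d\<in>Z. (plane_to_complex \<circ> transition c d \<circ> complex_to_plane)
        holomorphic_on plane_to_complex ` transition_dom c d)"

text \<open>The Wirtinger derivative with respect to the conjugate of the coordinate \<open>x + \<i>y\<close>.\<close>

definition dbar :: "'a chart \<Rightarrow> ('a \<Rightarrow> complex) \<Rightarrow> 'a \<Rightarrow> complex" where
  "dbar z f p = (pd z 1 f p + \<i> * pd z 2 f p) / 2"

end

(*
The metric pairing of X with the Lie bracket [X,Y] = - A0 X - A1 Y is - A0, and that of Y with it is - A1.
Since the bracket does not involve the connection, A0 and A1 may therefore be computed in any chart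
without the transformation law of the Christoffel symbols; this gives their regularity in
conformal charts. When |A| is constant the equation reduces to dbar A = 0, and a holomorphic function of
constant modulus is locally constant.

In terms of the connection form w, given by nabla_V X = w(V) Y and nabla_V Y = - w(V) X, one has
A0 = w(X) and A1 = w(Y). If both are constant then dw(X,Y) = - w([X,Y]) = A0^2 + A1^2, and the
curvature is K = - dw(X,Y). The density of vol(X) is sqrt (1 + w(X)^2 + w(Y)^2).
*)
theory Submission
  imports Defs
begin

(* With both meanings of the dollar sign active, parsing is exponential in the number of components. *)
no_notation fps_nth (infixl "$" 75)

section \<open>Calculus in the plane\<close>

text \<open>The scalar products \<open>A0\<close> and \<open>A1\<close> are evaluated at each point
  p in a chart chosen for that p alone, so their definition says nothing about how they vary near p.
  Comparing charts is the real obstacle. The bracket overcomes it because its transformation law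
  rests on the chain rule alone: the second derivatives of the transition map, being symmetric,
  cancel between the two fields.

  The regularity must be followed closely. Y is at first just a vector field; it becomes C^2 by
  being a quarter turn of X. The coefficients of w are then C^1, so dw makes sense, and the mixed
  second derivatives of X agree. This yields R(V,W)X = dw(V,W) Y, from which the curvature in
  coordinates is extracted.

  For the local constancy, the Cauchy-Riemann equations together with the vanishing gradient of
  |A|^2 form, at each point, a linear system for the derivatives of A whose determinant is - |A|^2.
  The case |A| = 0 is split off, and there A = 0 at once.\<close>

lemma has_derivative_partial:
  "f differentiable (at x) \<Longrightarrow> (f has_derivative frechet_derivative f (at x)) (at x)"
  by (simp flip: frechet_derivative_works)

lemma partial_transform:
  assumes "f differentiable (at x)" "open S" "x \<in> S" "\<And>y. y \<in> S \<Longrightarrow> f y = h y"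
  shows "h differentiable (at x)" "partial i h x = partial i f x"
proof -
  have *: "(h has_derivative frechet_derivative f (at x)) (at x)"
    using assms by (metis frechet_derivative_works has_derivative_transform_within_open)
  then show "h differentiable (at x)"
    by (auto simp: differentiable_def)
  show "partial i h x = partial i f x"
    using frechet_derivative_at [OF *] by (simp add: partial_def)
qed

lemma partial_eqI: "(f has_derivative f') (at x) \<Longrightarrow> partial i f x = f' (axis i 1)"
  by (simp add: partial_def flip: frechet_derivative_at)

text \<open>Off S differentiability is unknown and \<open>partial\<close> has unspecified values, so
  a differentiation rule identifies partial derivatives only on S. The closure rules for linear
  images, sums, products, inverses and roots finish their induction step with this congruence.
  Openness of S lets agreement on S pass to derivatives.\<close>

lemma Ck_on_cong:
  assumes "open S" "Ck_on k S f" "\<And>y. y \<in> S \<Longrightarrow> f y = h y"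
  shows "Ck_on k S h"
  using assms
proof (induction k arbitrary: f h)
  case 0
  then have "continuous_on S f = continuous_on S h"
    by (intro continuous_on_cong) auto
  with 0 show ?case by simp
next
  case (Suc k)
  have "h differentiable (at x)" "\<And>i. partial i f x = partial i h x" if "x \<in> S" for x
    using partial_transform [of f x S h] Suc.prems that by auto
  moreover have "Ck_on k S (partial i h)" for i
    by (rule Suc.IH [of "partial i f"]) (use Suc.prems calculation in auto)
  ultimately show ?case by simp
qed

lemma Ck_on_SucD: "Ck_on (Suc k) S f \<Longrightarrow> Ck_on k S f"
proof (induction k arbitrary: f)
  case 0
  then show ?case
    by (simp add: continuous_at_imp_continuous_on differentiable_imp_continuous_within)
next
  case (Suc k)
  then show ?case
    unfolding Ck_on.simps(2) [of "Suc k"] Ck_on.simps(2) [of k S f] by blast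
qed

lemma Ck_on_mono: "Ck_on k S f \<Longrightarrow> T \<subseteq> S \<Longrightarrow> Ck_on k T f"
  by (induction k arbitrary: f) (auto intro: continuous_on_subset)

section \<open>Closure rules for functions of class C^k\<close>

lemma Ck_on_bounded_linear:
  assumes "open S" "bounded_linear L" "Ck_on k S f"
  shows "Ck_on k S (\<lambda>x. L (f x))"
  using assms(3)
proof (induction k arbitrary: f)
  case 0
  then show ?case
    using assms(2) by (auto intro: bounded_linear.continuous_on)
next
  case (Suc k)
  have *: "((\<lambda>x. L (f x)) has_derivative (\<lambda>v. L (frechet_derivative f (at x) v))) (at x)"
    if "x \<in> S" for x
    by (rule bounded_linear.has_derivative [OF assms(2) has_derivative_partial]) (use Suc.prems that in auto)
  have d: "(\<lambda>x. L (f x)) differentiable (at x)" if "x \<in> S" for x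
    using * [OF that] by (rule differentiableI)
  have e: "partial i (\<lambda>x. L (f x)) x = L (partial i f x)" if "x \<in> S" for x i
    using partial_eqI [OF * [OF that], of i] by (simp only: partial_def)
  have "Ck_on k S (partial i (\<lambda>x. L (f x)))" for i
    by (rule Ck_on_cong [OF \<open>open S\<close> Suc.IH [of "partial i f"]]) (use Suc.prems e in auto)
  with d show ?case by simp
qed

lemma Ck_on_const: "Ck_on k S (\<lambda>x. a)"
proof (induction k arbitrary: a)
  case (Suc k)
  have "partial i (\<lambda>x. a) = (\<lambda>x. 0)" for i
    by (simp add: partial_def fun_eq_iff)
  with Suc.IH show ?case by simp
qed simp

lemma partial_const [simp]: "partial i (\<lambda>x. a) x = 0"
  by (simp add: partial_def)

lemma partial_add:
  assumes "f differentiable (at x)" "h differentiable (at x)"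
  shows "partial i (\<lambda>x. f x + h x) x = partial i f x + partial i h x"
  using partial_eqI [OF has_derivative_add [OF assms [THEN has_derivative_partial]]]
  by (simp add: partial_def)

lemma partial_mult:
  fixes f h :: "real^2 \<Rightarrow> real"
  assumes "f differentiable (at x)" "h differentiable (at x)"
  shows "partial i (\<lambda>x. f x * h x) x = f x * partial i h x + partial i f x * h x"
  using partial_eqI [OF has_derivative_mult [OF assms [THEN has_derivative_partial]]]
  by (simp add: partial_def)

lemma partial_compose_real:
  fixes f :: "real^2 \<Rightarrow> real"
  assumes "f differentiable (at x)" "(\<phi> has_real_derivative d) (at (f x))"
  shows "(\<lambda>x. \<phi> (f x)) differentiable (at x)" "partial i (\<lambda>x. \<phi> (f x)) x = d * partial i f x"
proof -
  have *: "((\<lambda>x. \<phi> (f x)) has_derivative (\<lambda>v. d * frechet_derivative f (at x) v)) (at x)"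
    using has_derivative_compose [OF has_derivative_partial [OF assms(1)], of \<phi> "(*) d"] assms(2)
    unfolding has_field_derivative_def by simp
  then show "(\<lambda>x. \<phi> (f x)) differentiable (at x)" by (auto simp: differentiable_def)
  show "partial i (\<lambda>x. \<phi> (f x)) x = d * partial i f x"
    using partial_eqI [OF *] by (simp add: partial_def)
qed

lemma Ck_on_add:
  assumes "open S" "Ck_on k S f" "Ck_on k S h"
  shows "Ck_on k S (\<lambda>x. f x + h x)"
  using assms(2,3)
proof (induction k arbitrary: f h)
  case (Suc k)
  have "Ck_on k S (partial i (\<lambda>x. f x + h x))" for i
    by (rule Ck_on_cong [OF \<open>open S\<close> Suc.IH [of "partial i f" "partial i h"]])
       (use Suc.prems in \<open>auto simp: partial_add\<close>)
  with Suc.prems show ?case by simp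
qed (simp add: continuous_on_add)

lemma Ck_on_mult:
  fixes f h :: "real^2 \<Rightarrow> real"
  assumes "open S" "Ck_on k S f" "Ck_on k S h"
  shows "Ck_on k S (\<lambda>x. f x * h x)"
  using assms(2,3)
proof (induction k arbitrary: f h)
  case (Suc k)
  have "Ck_on k S (\<lambda>x. f x * partial i h x + partial i f x * h x)" for i
    using Suc.prems Ck_on_SucD [OF Suc.prems(1)] Ck_on_SucD [OF Suc.prems(2)]
    by (intro Ck_on_add [OF \<open>open S\<close>] Suc.IH) auto
  with Suc.prems show ?case
    by (auto intro!: Ck_on_cong [OF \<open>open S\<close> \<open>Ck_on k S _\<close>] simp: partial_mult)
qed (simp add: continuous_on_mult)

text \<open>The derivative of 1/f is a product of 1/f itself with a partial derivative of f, so the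
  induction runs with f fixed. The same holds for the square root below.\<close>

lemma Ck_on_inverse:
  fixes f :: "real^2 \<Rightarrow> real"
  assumes "open S" "Ck_on k S f" "\<And>x. x \<in> S \<Longrightarrow> f x \<noteq> 0"
  shows "Ck_on k S (\<lambda>x. inverse (f x))"
  using assms(2)
proof (induction k)
  case (Suc k)
  have *: "Ck_on k S (\<lambda>x. -1 * (inverse (f x) * inverse (f x)) * partial i f x)" for i
    using Suc Ck_on_SucD [OF Suc.prems] by (intro Ck_on_mult Ck_on_const assms(1)) auto
  have d: "(inverse has_real_derivative -1 * (inverse (f x) * inverse (f x))) (at (f x))" if "x \<in> S" for x
    using DERIV_inverse [OF assms(3) [OF that]] by (simp add: power2_eq_square)
  show ?case
    using Suc.prems partial_compose_real [OF _ d]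
    by (auto intro!: Ck_on_cong [OF \<open>open S\<close> *])
qed (use assms in \<open>simp add: continuous_on_inverse\<close>)

lemma Ck_on_sqrt:
  fixes f :: "real^2 \<Rightarrow> real"
  assumes "open S" "Ck_on k S f" "\<And>x. x \<in> S \<Longrightarrow> f x > 0"
  shows "Ck_on k S (\<lambda>x. sqrt (f x))"
  using assms(2)
proof (induction k)
  case (Suc k)
  have nz: "sqrt (f x) \<noteq> 0" if "x \<in> S" for x
    using assms(3) [OF that] by simp
  have *: "Ck_on k S (\<lambda>x. (1/2) * inverse (sqrt (f x)) * partial i f x)" for i
    using Suc Ck_on_SucD [OF Suc.prems] nz
    by (intro Ck_on_mult Ck_on_const Ck_on_inverse assms(1)) (blast | simp)+
  have d: "(sqrt has_real_derivative (1/2) * inverse (sqrt (f x))) (at (f x))" if "x \<in> S" for x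
    using DERIV_real_sqrt [OF assms(3) [OF that]] by (simp add: mult.commute)
  show ?case
    using Suc.prems partial_compose_real [OF _ d]
    by (auto intro!: Ck_on_cong [OF \<open>open S\<close> *])
qed (use assms in \<open>simp add: continuous_on_real_sqrt\<close>)

text \<open>The mean value theorem is applied twice, first along direction i and then along
  direction j. The bound \<open>2 * h < r\<close> keeps the whole parallelogram in the ball.\<close>

lemma second_difference:
  fixes f :: "real^2 \<Rightarrow> real"
  assumes "h > 0"
    and "\<And>y. y \<in> ball x r \<Longrightarrow> f differentiable (at y)" "2 * h < r"
    and "\<And>y. y \<in> ball x r \<Longrightarrow> partial i f differentiable (at y)"
  shows "\<exists>y\<in>ball x r. f (x + h *\<^sub>R axis i 1 + h *\<^sub>R axis j 1) - f (x + h *\<^sub>R axis i 1)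
     - f (x + h *\<^sub>R axis j 1) + f x = h * h * partial j (partial i f) y"
proof -
  have line: "((\<lambda>s. \<phi> (a + s *\<^sub>R axis l 1)) has_real_derivative partial l \<phi> (a + s *\<^sub>R axis l 1)) (at s)"
    if "\<phi> differentiable (at (a + s *\<^sub>R axis l 1))" for \<phi> :: "real^2 \<Rightarrow> real" and a l s
  proof -
    note d = has_derivative_partial [OF that]
    have "((\<lambda>s. a + s *\<^sub>R axis l 1) has_derivative (\<lambda>t. t *\<^sub>R axis l 1)) (at s)"
      by (auto intro!: derivative_eq_intros)
    from has_derivative_compose [OF this d] 
    have "((\<lambda>s. \<phi> (a + s *\<^sub>R axis l 1)) has_derivative
       (\<lambda>t. frechet_derivative \<phi> (at (a + s *\<^sub>R axis l 1)) (t *\<^sub>R axis l 1))) (at s)" by simp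
    then show ?thesis
      using linear_scale [OF has_derivative_linear [OF d]]
      by (simp add: has_field_derivative_def partial_def mult_commute_abs)
  qed
  have B: "x + s *\<^sub>R axis i 1 + t *\<^sub>R axis j 1 \<in> ball x r" if "0 \<le> s" "s \<le> h" "0 \<le> t" "t \<le> h" for s t
  proof -
    have "norm (s *\<^sub>R axis i 1 + t *\<^sub>R axis j 1 :: real^2) \<le> s + t"
      using that by (intro norm_triangle_le) auto
    also have "\<dots> < r" using that assms by auto
    finally show ?thesis
      by (metis add.assoc add_diff_cancel_left' dist_norm mem_ball norm_minus_commute)
  qed
  have B0: "x + s *\<^sub>R axis i 1 \<in> ball x r" if "0 \<le> s" "s \<le> h" for s
    using B [OF that, of 0] \<open>h > 0\<close> by simp
  \<comment> \<open>The increment of f in direction j, as a function of the position along direction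
    i; \<open>\<phi> h - \<phi> 0\<close> is the second difference.\<close>
  define \<phi> where "\<phi> s = f (x + h *\<^sub>R axis j 1 + s *\<^sub>R axis i 1) - f (x + s *\<^sub>R axis i 1)" for s
  have "\<exists>\<xi>. 0 < \<xi> \<and> \<xi> < h \<and> \<phi> h - \<phi> 0 = (h - 0) *
      (partial i f (x + h *\<^sub>R axis j 1 + \<xi> *\<^sub>R axis i 1) - partial i f (x + \<xi> *\<^sub>R axis i 1))"
    unfolding \<phi>_def using \<open>h > 0\<close> B [of _ h] B0
    by (intro MVT2 DERIV_diff line assms) (auto simp: add_ac)
  then obtain \<xi> where \<xi>: "0 < \<xi>" "\<xi> < h" "\<phi> h - \<phi> 0 = h *
      (partial i f (x + \<xi> *\<^sub>R axis i 1 + h *\<^sub>R axis j 1) - partial i f (x + \<xi> *\<^sub>R axis i 1))"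
    by (auto simp: add_ac)
  have "\<exists>\<eta>. 0 < \<eta> \<and> \<eta> < h \<and> partial i f (x + \<xi> *\<^sub>R axis i 1 + h *\<^sub>R axis j 1)
      - partial i f (x + \<xi> *\<^sub>R axis i 1 + 0 *\<^sub>R axis j 1)
      = (h - 0) * partial j (partial i f) (x + \<xi> *\<^sub>R axis i 1 + \<eta> *\<^sub>R axis j 1)"
    using \<open>h > 0\<close> B [of \<xi>] \<xi> by (intro MVT2 line assms) auto
  then obtain \<eta> where "0 < \<eta>" "\<eta> < h" "partial i f (x + \<xi> *\<^sub>R axis i 1 + h *\<^sub>R axis j 1)
      - partial i f (x + \<xi> *\<^sub>R axis i 1) = h * partial j (partial i f) (x + \<xi> *\<^sub>R axis i 1 + \<eta> *\<^sub>R axis j 1)"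
    by auto
  with \<xi> have "\<phi> h - \<phi> 0 = h * h * partial j (partial i f) (x + \<xi> *\<^sub>R axis i 1 + \<eta> *\<^sub>R axis j 1)"
    by simp
  moreover have "x + h *\<^sub>R axis j 1 + h *\<^sub>R axis i 1 = x + h *\<^sub>R axis i 1 + h *\<^sub>R axis j 1"
    by simp
  ultimately show ?thesis
    using B [of \<xi> \<eta>] \<xi> \<open>0 < \<eta>\<close> \<open>\<eta> < h\<close>
    by (intro bexI [of _ "x + \<xi> *\<^sub>R axis i 1 + \<eta> *\<^sub>R axis j 1"]) (simp_all add: \<phi>_def)
qed

text \<open>Schwarz's theorem: the second difference is symmetric in i and j, so the two mixed
  derivatives take a common value at points arbitrarily close to x, and continuity carries this to
  x.\<close>

lemma partial_commute:
  fixes f :: "real^2 \<Rightarrow> real"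
  assumes "open S" "x \<in> S" "Ck_on 2 S f"
  shows "partial i (partial j f) x = partial j (partial i f) x"
proof -
  have near: "\<exists>r>0. \<forall>y\<in>ball x r. \<bar>partial l (partial k f) y - partial l (partial k f) x\<bar> < e"
    if "e > 0" for e k l
  proof -
    have "continuous_on S (partial l (partial k f))"
      using assms(3) by (simp add: numeral_2_eq_2)
    then have "isCont (partial l (partial k f)) x"
      using assms continuous_on_eq_continuous_at by blast
    then obtain r where "r > 0" "partial l (partial k f) ` ball x r \<subseteq> ball (partial l (partial k f) x) e"
      using \<open>e > 0\<close> unfolding continuous_at_ball by blast
    then show ?thesis
      by (intro exI [of _ r]) (auto simp: dist_real_def abs_minus_commute image_subset_iff)
  qed
  show ?thesis
  proof (rule ccontr)
    assume neq: "partial i (partial j f) x \<noteq> partial j (partial i f) x"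
    \<comment> \<open>Half of the supposed gap: a number closer than e to both mixed derivatives at
      x contradicts the triangle inequality.\<close>
    define e where "e = \<bar>partial i (partial j f) x - partial j (partial i f) x\<bar> / 2"
    have "e > 0" using neq by (simp add: e_def)
    obtain r1 where r1: "r1 > 0" "\<And>y. y \<in> ball x r1 \<Longrightarrow> \<bar>partial i (partial j f) y - partial i (partial j f) x\<bar> < e"
      using near [OF \<open>e > 0\<close>] by metis
    obtain r2 where r2: "r2 > 0" "\<And>y. y \<in> ball x r2 \<Longrightarrow> \<bar>partial j (partial i f) y - partial j (partial i f) x\<bar> < e"
      using near [OF \<open>e > 0\<close>] by metis
    obtain r3 where r3: "r3 > 0" "ball x r3 \<subseteq> S"
      using assms openE by blast
    define r where "r = Min {r1, r2, r3}"
    have r: "r > 0" "r \<le> r1" "r \<le> r2" "r \<le> r3"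
      using r1 r2 r3 by (auto simp: r_def)
    then have sub: "ball x r \<subseteq> ball x r1" "ball x r \<subseteq> ball x r2" "ball x r \<subseteq> S"
      using r3 by auto
    define h where "h = r / 3"
    have h: "h > 0" "2 * h < r" using r by (auto simp: h_def)
    have d: "f differentiable (at y)" "partial k f differentiable (at y)" if "y \<in> ball x r" for y k
      using assms(3) sub that by (auto simp: numeral_2_eq_2)
    obtain y where y: "y \<in> ball x r" "f (x + h *\<^sub>R axis i 1 + h *\<^sub>R axis j 1) - f (x + h *\<^sub>R axis i 1)
     - f (x + h *\<^sub>R axis j 1) + f x = h * h * partial j (partial i f) y"
      using second_difference [of h x r f i j] d h by auto
    obtain z where z: "z \<in> ball x r" "f (x + h *\<^sub>R axis j 1 + h *\<^sub>R axis i 1) - f (x + h *\<^sub>R axis j 1)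
     - f (x + h *\<^sub>R axis i 1) + f x = h * h * partial i (partial j f) z"
      using second_difference [of h x r f j i] d h by auto
    have swap: "x + h *\<^sub>R axis j 1 + h *\<^sub>R axis i 1 = x + h *\<^sub>R axis i 1 + h *\<^sub>R axis j 1"
      by simp
    have "h * h * partial j (partial i f) y = h * h * partial i (partial j f) z"
      using y(2) z(2) [unfolded swap] by linarith
    then have "partial j (partial i f) y = partial i (partial j f) z"
      using h by simp
    moreover have "\<bar>partial j (partial i f) y - partial j (partial i f) x\<bar> < e"
      "\<bar>partial i (partial j f) z - partial i (partial j f) x\<bar> < e"
      using r1 r2 y z sub by auto
    ultimately have "dist (partial i (partial j f) x) (partial j (partial i f) x) < 2 * e"
      using dist_triangle_half_l [of "partial i (partial j f) x" "partial j (partial i f) y" "2 * e"]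
      by (simp add: dist_real_def abs_minus_commute)
    then show False
      by (simp add: e_def dist_real_def)
  qed
qed

section \<open>Calculus in a chart\<close>

text \<open>Let P have rows x and y and let G be the symmetric matrix with entries a, b, d. The
  hypotheses say that P G times the transpose of P is the identity. Hence the transpose of P times P
  is the inverse of G, which is what the last four equations express, while the first one is the
  determinant.\<close>

lemma gram_inverse:
  fixes a b d :: real
  assumes "a*x1*x1 + 2*b*x1*x2 + d*x2*x2 = 1" "a*x1*y1 + b*(x1*y2 + x2*y1) + d*x2*y2 = 0"
    "a*y1*y1 + 2*b*y1*y2 + d*y2*y2 = 1"
  shows "(x1*y2 - x2*y1)^2 * (a*d - b*b) = 1"
    "(x1*x1 + y1*y1) * a + (x1*x2 + y1*y2) * b = 1"
    "(x1*x1 + y1*y1) * b + (x1*x2 + y1*y2) * d = 0"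
    "(x1*x2 + y1*y2) * a + (x2*x2 + y2*y2) * b = 0"
    "(x1*x2 + y1*y2) * b + (x2*x2 + y2*y2) * d = 1"
proof -
  define D where "D = x1*y2 - x2*y1"
  \<comment> \<open>The entries of P G.\<close>
  define m11 m12 m21 m22 where "m11 = a*x1 + b*x2" and "m12 = b*x1 + d*x2"
    and "m21 = a*y1 + b*y2" and "m22 = b*y1 + d*y2"
  note m = m11_def m12_def m21_def m22_def
  have 1: "m11*x1 + m12*x2 = 1" "m11*y1 + m12*y2 = 0" "m21*x1 + m22*x2 = 0" "m21*y1 + m22*y2 = 1"
    using assms by (simp_all add: m algebra_simps)
  have "(x1*y2 - x2*y1)^2 * (a*d - b*b) = (m11*x1 + m12*x2) * (m21*y1 + m22*y2)
      - (m11*y1 + m12*y2) * (m21*x1 + m22*x2)"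
    by (simp add: m algebra_simps power2_eq_square)
  then show det: "(x1*y2 - x2*y1)^2 * (a*d - b*b) = 1"
    using 1 by simp
  then have "D \<noteq> 0" by (auto simp: D_def)
  \<comment> \<open>Cramer's rule, solving the system for P G in terms of P and its determinant
    D.\<close>
  have "D * m11 = y2 * (m11*x1 + m12*x2) - x2 * (m11*y1 + m12*y2)"
    "D * m12 = x1 * (m11*y1 + m12*y2) - y1 * (m11*x1 + m12*x2)"
    "D * m21 = y2 * (m21*x1 + m22*x2) - x2 * (m21*y1 + m22*y2)"
    "D * m22 = x1 * (m21*y1 + m22*y2) - y1 * (m21*x1 + m22*x2)"
    by (simp_all add: D_def algebra_simps)
  then have cramer: "D * m11 = y2" "D * m12 = - y1" "D * m21 = - x2" "D * m22 = x1"
    using 1 by simp_all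
  have lin: "D * (s * m11 + t * m21) = s * (D * m11) + t * (D * m21)"
    "D * (s * m12 + t * m22) = s * (D * m12) + t * (D * m22)" for s t
    by (simp_all add: algebra_simps)
  have "D * (x1*m11 + y1*m21) = D * 1" "D * (x1*m12 + y1*m22) = D * 0"
    "D * (x2*m11 + y2*m21) = D * 0" "D * (x2*m12 + y2*m22) = D * 1"
    unfolding lin cramer by (simp_all add: D_def mult.commute)
  then have 2: "x1*m11 + y1*m21 = 1" "x1*m12 + y1*m22 = 0" "x2*m11 + y2*m21 = 0" "x2*m12 + y2*m22 = 1"
    using \<open>D \<noteq> 0\<close> unfolding mult_cancel_left by simp_all
  show "(x1*x1 + y1*y1) * a + (x1*x2 + y1*y2) * b = 1"
    "(x1*x1 + y1*y1) * b + (x1*x2 + y1*y2) * d = 0"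
    "(x1*x2 + y1*y2) * a + (x2*x2 + y2*y2) * b = 0"
    "(x1*x2 + y1*y2) * b + (x2*x2 + y2*y2) * d = 1"
    using 2 by (simp_all add: m algebra_simps)
qed

lemma metric_in_2: "metric_in g c p v w = g c p $ 1 $ 1 * v $ 1 * w $ 1 + g c p $ 1 $ 2 * v $ 1 * w $ 2
    + g c p $ 2 $ 1 * v $ 2 * w $ 1 + g c p $ 2 $ 2 * v $ 2 * w $ 2"
  unfolding metric_in_def inner_vec_def matrix_vector_mult_def
  by (simp only: sum_2 inner_real_def vec_lambda_beta distrib_left mult_ac add_ac)

definition Ck_in :: "'a chart \<Rightarrow> nat \<Rightarrow> 'a set \<Rightarrow> ('a \<Rightarrow> 'b::real_normed_vector) \<Rightarrow> bool" where
  "Ck_in c k W f \<longleftrightarrow> Ck_on k (coord c ` W) (f \<circ> param c)"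

text \<open>W is the whole domain when one chart is studied, and the overlap of two domains when
  charts are compared.\<close>

locale chart_region =
  fixes c :: "'a::topological_space chart" and W :: "'a set"
  assumes chart: "is_chart c" and open_W: "open W" and W_sub: "W \<subseteq> dom_of c"
begin

lemma param_coord: "p \<in> W \<Longrightarrow> param c (coord c p) = p"
  using chart W_sub by (auto simp: is_chart_def homeomorphism_def)

lemma open_image: "open (coord c ` W)"
proof -
  have "openin (top_of_set (coord c ` dom_of c)) (coord c ` W)"
    using chart W_sub open_W unfolding is_chart_def
    by (intro homeomorphism_imp_open_map [of "dom_of c" _ "coord c" "param c"])
       (auto intro: open_subset)
  then show ?thesis
    using chart by (auto simp: is_chart_def openin_open_eq)
qed

lemma Ck_in_cong:
  assumes "Ck_in c k W f" "\<And>q. q \<in> W \<Longrightarrow> f q = h q"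
  shows "Ck_in c k W h"
  using assms param_coord unfolding Ck_in_def
  by (intro Ck_on_cong [OF open_image, of k "f \<circ> param c" "h \<circ> param c"]) auto

lemma C1_differentiable:
  "Ck_in c 1 W f \<Longrightarrow> p \<in> W \<Longrightarrow> (f \<circ> param c) differentiable (at (coord c p))"
  by (auto simp: Ck_in_def)

lemma Ck_in_SucD: "Ck_in c (Suc k) W f \<Longrightarrow> Ck_in c k W f"
  unfolding Ck_in_def by (rule Ck_on_SucD)

lemma C2_C1: "Ck_in c 2 W f \<Longrightarrow> Ck_in c 1 W f"
  using Ck_in_SucD [of 1 f] by (simp add: numeral_2_eq_2)

lemma Ck_in_pd: "Ck_in c (Suc k) W f \<Longrightarrow> Ck_in c k W (pd c i f)"
  unfolding Ck_in_def
  by (rule Ck_on_cong [OF open_image, of k "partial i (f \<circ> param c)"])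
     (auto simp: pd_def param_coord)

lemma C2_pd: "Ck_in c 2 W f \<Longrightarrow> Ck_in c 1 W (pd c i f)"
  using Ck_in_pd [of 1 f] by (simp add: numeral_2_eq_2)

lemma pd_cong:
  assumes "Ck_in c 1 W f" "\<And>q. q \<in> W \<Longrightarrow> f q = h q" "p \<in> W"
  shows "pd c i f p = pd c i h p"
  unfolding pd_def
  by (rule partial_transform(2) [OF C1_differentiable [OF assms(1,3)] open_image, symmetric])
     (use assms param_coord in auto)

lemma pd_const [simp]: "pd c i (\<lambda>q. a) p = 0"
  by (simp add: pd_def comp_def)

lemma pd_const_on:
  assumes "\<And>q. q \<in> W \<Longrightarrow> f q = a" "p \<in> W"
  shows "pd c i f p = 0"
proof -
  have "Ck_in c 1 W (\<lambda>q. a)"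
    using Ck_on_const by (simp add: Ck_in_def comp_def)
  from pd_cong [OF this, of f p i] assms show ?thesis by simp
qed

lemma pd_add:
  assumes "Ck_in c 1 W f" "Ck_in c 1 W h" "p \<in> W"
  shows "pd c i (\<lambda>q. f q + h q) p = pd c i f p + pd c i h p"
  using partial_add [OF assms(1,2) [THEN C1_differentiable, OF assms(3)]]
  by (simp add: pd_def comp_def)

lemma pd_mult:
  fixes f h :: "'a \<Rightarrow> real"
  assumes "Ck_in c 1 W f" "Ck_in c 1 W h" "p \<in> W"
  shows "pd c i (\<lambda>q. f q * h q) p = f p * pd c i h p + pd c i f p * h p"
  using partial_mult [OF assms(1,2) [THEN C1_differentiable, OF assms(3)]] assms(3)
  by (simp add: pd_def comp_def param_coord)

lemma pd_bounded_linear: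
  assumes "bounded_linear L" "Ck_in c 1 W f" "p \<in> W"
  shows "pd c i (\<lambda>q. L (f q)) p = L (pd c i f p)"
  using partial_eqI [OF bounded_linear.has_derivative [OF assms(1)
      has_derivative_partial [OF C1_differentiable [OF assms(2,3)]]]]
  by (simp add: pd_def comp_def partial_def)

lemma pd_commute:
  fixes f :: "'a \<Rightarrow> real"
  assumes "Ck_in c 2 W f" "p \<in> W"
  shows "pd c i (pd c j f) p = pd c j (pd c i f) p"
proof -
  have *: "pd c i (pd c j f) p = partial i (partial j (f \<circ> param c)) (coord c p)" for i j
  proof -
    have "partial i (pd c j f \<circ> param c) (coord c p) = partial i (partial j (f \<circ> param c)) (coord c p)"
      by (rule partial_transform(2) [OF _ open_image])
         (use assms in \<open>auto simp: pd_def param_coord Ck_in_def numeral_2_eq_2\<close>)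
    then show ?thesis by (simp add: pd_def)
  qed
  show ?thesis
    unfolding * using assms by (intro partial_commute [OF open_image]) (auto simp: Ck_in_def)
qed

lemma Ck_in_const: "Ck_in c k W (\<lambda>q. a)"
  using Ck_on_const by (simp add: Ck_in_def comp_def)

lemma Ck_in_bounded_linear: "bounded_linear L \<Longrightarrow> Ck_in c k W f \<Longrightarrow> Ck_in c k W (\<lambda>q. L (f q))"
  unfolding Ck_in_def using Ck_on_bounded_linear [OF open_image] by (auto simp: comp_def)

lemma Ck_in_nth: "Ck_in c k W f \<Longrightarrow> Ck_in c k W (\<lambda>q. f q $ i)"
  by (rule Ck_in_bounded_linear [OF bounded_linear_vec_nth])

lemma Ck_in_add: "Ck_in c k W f \<Longrightarrow> Ck_in c k W h \<Longrightarrow> Ck_in c k W (\<lambda>q. f q + h q)"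
  unfolding Ck_in_def using Ck_on_add [OF open_image] by (auto simp: comp_def)

lemma Ck_in_mult:
  fixes f h :: "'a \<Rightarrow> real"
  shows "Ck_in c k W f \<Longrightarrow> Ck_in c k W h \<Longrightarrow> Ck_in c k W (\<lambda>q. f q * h q)"
  unfolding Ck_in_def using Ck_on_mult [OF open_image] by (auto simp: comp_def)

lemma Ck_in_uminus:
  fixes f :: "'a \<Rightarrow> real"
  shows "Ck_in c k W f \<Longrightarrow> Ck_in c k W (\<lambda>q. - f q)"
  by (rule Ck_in_bounded_linear [OF bounded_linear_minus [OF bounded_linear_ident]])

lemma Ck_in_diff:
  fixes f h :: "'a \<Rightarrow> real"
  shows "Ck_in c k W f \<Longrightarrow> Ck_in c k W h \<Longrightarrow> Ck_in c k W (\<lambda>q. f q - h q)"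
  using Ck_in_add [OF _ Ck_in_uminus] by fastforce

lemma Ck_in_inverse:
  fixes f :: "'a \<Rightarrow> real"
  shows "Ck_in c k W f \<Longrightarrow> (\<And>q. q \<in> W \<Longrightarrow> f q \<noteq> 0) \<Longrightarrow> Ck_in c k W (\<lambda>q. inverse (f q))"
  unfolding Ck_in_def comp_def by (rule Ck_on_inverse [OF open_image]) (auto simp: param_coord)

lemma Ck_in_sqrt:
  fixes f :: "'a \<Rightarrow> real"
  shows "Ck_in c k W f \<Longrightarrow> (\<And>q. q \<in> W \<Longrightarrow> f q > 0) \<Longrightarrow> Ck_in c k W (\<lambda>q. sqrt (f q))"
  unfolding Ck_in_def comp_def by (rule Ck_on_sqrt [OF open_image]) (auto simp: param_coord)

lemmas Ck_in_intros = Ck_in_const Ck_in_nth Ck_in_add Ck_in_mult Ck_in_uminus Ck_in_diff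

end

section \<open>The Levi-Civita connection in a chart\<close>

text \<open>\<open>matrix_inv\<close> is a choice of a two-sided inverse. Multiplying the right
  inverse \<open>?B\<close> by it from the left shows that the two coincide.\<close>

lemma matrix_inv_2:
  fixes M :: "real^2^2"
  assumes "det M \<noteq> 0"
  shows "matrix_inv M = vector [vector [M $ 2 $ 2 / det M, - (M $ 1 $ 2 / det M)],
    vector [- (M $ 2 $ 1 / det M), M $ 1 $ 1 / det M]]" (is "_ = ?B")
    and "M ** matrix_inv M = mat 1"
proof -
  have "invertible M" using assms by (simp add: invertible_det_nz)
  then have inv: "M ** matrix_inv M = mat 1 \<and> matrix_inv M ** M = mat 1"
    unfolding matrix_inv_def invertible_def by (rule someI_ex)
  have "M ** ?B = mat 1"
    using assms by (simp add: vec_eq_iff matrix_matrix_mult_def sum_2 forall_2 mat_def field_simps)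
      (simp add: det_2)
  then have "matrix_inv M = matrix_inv M ** (M ** ?B)" by simp
  also have "\<dots> = ?B" using inv by (simp add: matrix_mul_assoc)
  finally have "matrix_inv M = ?B" .
  then show "matrix_inv M = ?B" "M ** matrix_inv M = mat 1" using inv by auto
qed

lemma metric_in_linear:
  "metric_in g c p (u + v) w = metric_in g c p u w + metric_in g c p v w"
  "metric_in g c p u (v + w) = metric_in g c p u v + metric_in g c p u w"
  "metric_in g c p (a *\<^sub>R v) w = a * metric_in g c p v w"
  "metric_in g c p v (a *\<^sub>R w) = a * metric_in g c p v w"
  "metric_in g c p (- v) w = - metric_in g c p v w"
  "metric_in g c p v (- w) = - metric_in g c p v w"
  by (simp_all add: metric_in_2 algebra_simps)

lemma nabla_axis:
  "nabla_in g c p (axis i 1) X $ k =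
     pd c i (\<lambda>q. X c q $ k) p + (\<Sum>j\<in>UNIV. christoffel g c k i j p * X c p $ j)"
  by (simp add: nabla_in_def axis_def if_distrib [of "\<lambda>t. t * _"] cong: if_cong)

lemma nabla_in_expand:
  "nabla_in g c p v X = v $ 1 *\<^sub>R nabla_in g c p (axis 1 1) X + v $ 2 *\<^sub>R nabla_in g c p (axis 2 1) X"
  unfolding vec_eq_iff vector_add_component vector_scaleR_component nabla_axis
  by (simp add: nabla_in_def sum_2)

locale metric_chart = chart_region c "dom_of c" for c :: "'a::topological_space chart" +
  fixes g :: "'a gram"
  assumes smooth: "smooth_on (coord c ` dom_of c) (g c \<circ> param c)"
    and gram_sym: "p \<in> dom_of c \<Longrightarrow> g c p $ i $ j = g c p $ j $ i"
    and gram_pos: "p \<in> dom_of c \<Longrightarrow> v \<noteq> 0 \<Longrightarrow> metric_in g c p v v > 0"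
begin

lemma metric_commute: "p \<in> dom_of c \<Longrightarrow> metric_in g c p v w = metric_in g c p w v"
  by (simp add: metric_in_2 gram_sym [of p 2 1])

lemma det_gram: "p \<in> dom_of c \<Longrightarrow> det (g c p) = g c p $ 1 $ 1 * g c p $ 2 $ 2 - (g c p $ 1 $ 2)\<^sup>2"
  by (simp add: det_2 gram_sym [of p 2 1] power2_eq_square)

lemma det_pos:
  assumes "p \<in> dom_of c"
  shows "det (g c p) > 0"
proof -
  let ?a = "g c p $ 1 $ 1" and ?b = "g c p $ 1 $ 2"
  have "(vector [1, 0] :: real^2) \<noteq> 0" by (simp add: vec_eq_iff forall_2)
  from gram_pos [OF assms this] have a: "?a > 0" by (simp add: metric_in_2)
  \<comment> \<open>This vector is orthogonal to the first coordinate vector, and its squared length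
    is \<open>?a * det (g c p)\<close>.\<close>
  then have "(vector [- ?b, ?a] :: real^2) \<noteq> 0" by (simp add: vec_eq_iff forall_2)
  from gram_pos [OF assms this] have "?a * det (g c p) > 0"
    by (simp add: metric_in_2 det_2 gram_sym [OF assms, of 2 1] algebra_simps)
  with a show ?thesis by (simp add: zero_less_mult_iff)
qed

lemma Ck_gram: "Ck_in c k (dom_of c) (\<lambda>q. g c q $ i $ j)"
  using smooth by (intro Ck_in_nth) (simp add: Ck_in_def smooth_on_def)

lemma Ck_det: "Ck_in c k (dom_of c) (\<lambda>q. det (g c q))"
  unfolding det_2 by (intro Ck_in_intros Ck_gram)

lemma Ck_matrix_inv: "Ck_in c k (dom_of c) (\<lambda>q. matrix_inv (g c q) $ i $ j)"
proof -
  have *: "Ck_in c k (dom_of c) (\<lambda>q. s * (g c q $ a $ b * inverse (det (g c q))))" for s a b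
    by (intro Ck_in_intros Ck_gram Ck_in_inverse Ck_det) (use det_pos in force)
  \<comment> \<open>Sign and position of the entry of g that forms the adjugate: the opposite entry
    on the diagonal, minus the same entry off it.\<close>
  define s a b where "s = (if i = j then 1 else - 1 :: real)"
    and "a = (if i = j then (if i = 1 then 2 else 1) else i)"
    and "b = (if i = j then (if i = 1 then 2 else 1) else j)"
  have "s * (g c q $ a $ b * inverse (det (g c q))) = matrix_inv (g c q) $ i $ j" if "q \<in> dom_of c" for q
    using exhaust_2 [of i] exhaust_2 [of j] det_pos [OF that]
    by (auto simp: s_def a_def b_def matrix_inv_2 divide_inverse)
  then show ?thesis
    by (rule Ck_in_cong [OF *])
qed

lemma Ck_christoffel: "Ck_in c k (dom_of c) (christoffel g c l i j)"
proof -
  have eq: "christoffel g c l i j = (\<lambda>p. (\<Sum>m\<in>UNIV. matrix_inv (g c p) $ l $ m *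
        (pd c i (\<lambda>q. g c q $ j $ m) p + pd c j (\<lambda>q. g c q $ i $ m) p
           - pd c m (\<lambda>q. g c q $ i $ j) p)) * (1 / 2))"
    by (simp add: christoffel_def fun_eq_iff)
  show ?thesis
    unfolding eq sum_2
    by (intro Ck_in_mult Ck_in_const Ck_in_add Ck_in_diff Ck_matrix_inv Ck_in_pd Ck_gram)
qed

lemma pd_gram_sym: "p \<in> dom_of c \<Longrightarrow> pd c m (\<lambda>q. g c q $ i $ j) p = pd c m (\<lambda>q. g c q $ j $ i) p"
  by (rule pd_cong [OF Ck_gram]) (auto simp: gram_sym)

lemma christoffel_sym: "p \<in> dom_of c \<Longrightarrow> christoffel g c k i j p = christoffel g c k j i p"
  by (simp add: christoffel_def pd_gram_sym [of p _ i j] add.commute)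

text \<open>Lowering the upper index cancels the inverse Gram matrix and leaves the Christoffel
  symbols of the first kind.\<close>

lemma christoffel_lower:
  assumes p: "p \<in> dom_of c"
  shows "(\<Sum>k\<in>UNIV. g c p $ m $ k * christoffel g c k i j p) =
    (pd c i (\<lambda>q. g c q $ j $ m) p + pd c j (\<lambda>q. g c q $ i $ m) p
           - pd c m (\<lambda>q. g c q $ i $ j) p) / 2"
proof -
  define t where "t l = pd c i (\<lambda>q. g c q $ j $ l) p + pd c j (\<lambda>q. g c q $ i $ l) p
           - pd c l (\<lambda>q. g c q $ i $ j) p" for l
  have "(\<Sum>k\<in>UNIV. g c p $ m $ k * christoffel g c k i j p) =
     (\<Sum>l\<in>UNIV. (g c p ** matrix_inv (g c p)) $ m $ l * t l) / 2"
    by (simp add: christoffel_def t_def sum_2 matrix_matrix_mult_def field_simps)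
  also have "\<dots> = (\<Sum>l\<in>UNIV. (mat 1 :: real^2^2) $ m $ l * t l) / 2"
    using matrix_inv_2(2) det_pos [OF p] by simp
  also have "\<dots> = t m / 2"
    by (simp add: mat_def if_distrib [of "\<lambda>s. s * _"] cong: if_cong)
  finally show ?thesis by (simp add: t_def)
qed

text \<open>Compatibility of the connection with the metric. Symmetrizing the symbols of the first
  kind \<open>L m j\<close> in m and j leaves only the i-th derivative of the Gram entry (m,j),
  which is the term that the product rule produces.\<close>

lemma nabla_metric:
  assumes X: "\<And>k. Ck_in c 1 (dom_of c) (\<lambda>q. X c q $ k)" and Y: "\<And>k. Ck_in c 1 (dom_of c) (\<lambda>q. Y c q $ k)"
    and p: "p \<in> dom_of c"
  shows "pd c i (\<lambda>q. metric_in g c q (X c q) (Y c q)) p =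
    metric_in g c p (nabla_in g c p (axis i 1) X) (Y c p) + metric_in g c p (X c p) (nabla_in g c p (axis i 1) Y)"
proof -
  define L where "L m j = g c p $ m $ 1 * christoffel g c 1 i j p + g c p $ m $ 2 * christoffel g c 2 i j p" for m j
  have L: "L m j + L j m = pd c i (\<lambda>q. g c q $ m $ j) p" for m j
    using christoffel_lower [OF p, of m i j] christoffel_lower [OF p, of j i m]
      pd_gram_sym [OF p, of i j m] pd_gram_sym [OF p, of m i j] pd_gram_sym [OF p, of j i m]
    by (simp add: L_def sum_2 field_simps)
  have "metric_in g c p (nabla_in g c p (axis i 1) X) (Y c p) + metric_in g c p (X c p) (nabla_in g c p (axis i 1) Y)
    = metric_in g c p (\<chi> k. pd c i (\<lambda>q. X c q $ k) p) (Y c p)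
     + metric_in g c p (X c p) (\<chi> k. pd c i (\<lambda>q. Y c q $ k) p)
     + ((L 1 1 + L 1 1) * X c p $ 1 * Y c p $ 1 + (L 1 2 + L 2 1) * X c p $ 1 * Y c p $ 2
     + (L 2 1 + L 1 2) * X c p $ 2 * Y c p $ 1 + (L 2 2 + L 2 2) * X c p $ 2 * Y c p $ 2)"
    by (simp add: metric_in_2 nabla_axis sum_2 L_def gram_sym [OF p, of 2 1] algebra_simps)
  also have "\<dots> = pd c i (\<lambda>q. metric_in g c q (X c q) (Y c q)) p"
    unfolding L metric_in_2
    by (simp add: pd_add pd_mult Ck_in_add Ck_in_mult Ck_gram [of 1, simplified] X [simplified] Y [simplified] p algebra_simps)
  finally show ?thesis by simp
qed

end

section \<open>Orthonormal frames in a chart\<close>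

definition lie_bracket :: "'a chart \<Rightarrow> 'a vfield \<Rightarrow> 'a vfield \<Rightarrow> 'a \<Rightarrow> real^2" where
  "lie_bracket c X Y p = (\<chi> k. \<Sum>i\<in>UNIV. X c p $ i * pd c i (\<lambda>q. Y c q $ k) p
     - Y c p $ i * pd c i (\<lambda>q. X c q $ k) p)"

text \<open>The regularity of Y is assumed here; for a direct frame it will be derived from that of
  X.\<close>

locale frame_chart = metric_chart c g for c :: "'a::topological_space chart" and g :: "'a gram" +
  fixes X Y :: "'a vfield"
  assumes C2_X: "Ck_in c 2 (dom_of c) (\<lambda>q. X c q $ k)"
    and C2_Y: "Ck_in c 2 (dom_of c) (\<lambda>q. Y c q $ k)"
    and XX: "p \<in> dom_of c \<Longrightarrow> metric_in g c p (X c p) (X c p) = 1"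
    and XY: "p \<in> dom_of c \<Longrightarrow> metric_in g c p (X c p) (Y c p) = 0"
    and YY: "p \<in> dom_of c \<Longrightarrow> metric_in g c p (Y c p) (Y c p) = 1"
begin

text \<open>The coefficients of the connection form w in the coordinates of c.\<close>

definition conn :: "2 \<Rightarrow> 'a \<Rightarrow> real" where
  "conn i p = metric_in g c p (nabla_in g c p (axis i 1) X) (Y c p)"

text \<open>The value of the coordinate area form on (X,Y); it converts coefficients of 2-forms into
  values on the frame.\<close>

definition frame_det :: "'a \<Rightarrow> real" where
  "frame_det p = X c p $ 1 * Y c p $ 2 - X c p $ 2 * Y c p $ 1"

lemmas C2_nth = C2_X C2_Y

lemmas C1_nth = C2_nth [THEN C2_C1]

text \<open>With P the matrix of rows X and Y, both parts come from \<open>gram_inverse\<close>: the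
  expansion of V says that the transpose of P times P G fixes V.\<close>

lemma frame_gram:
  assumes p: "p \<in> dom_of c"
  shows "(frame_det p)\<^sup>2 * det (g c p) = 1"
    and "V = metric_in g c p V (X c p) *\<^sub>R X c p + metric_in g c p V (Y c p) *\<^sub>R Y c p"
proof -
  note gram = gram_inverse [of "g c p $ 1 $ 1" "X c p $ 1" "g c p $ 1 $ 2" "X c p $ 2" "g c p $ 2 $ 2"
      "Y c p $ 1" "Y c p $ 2"]
  have prem: "g c p $ 1 $ 1 * X c p $ 1 * X c p $ 1 + 2 * g c p $ 1 $ 2 * X c p $ 1 * X c p $ 2
       + g c p $ 2 $ 2 * X c p $ 2 * X c p $ 2 = 1"
    "g c p $ 1 $ 1 * X c p $ 1 * Y c p $ 1 + g c p $ 1 $ 2 * (X c p $ 1 * Y c p $ 2 + X c p $ 2 * Y c p $ 1)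
       + g c p $ 2 $ 2 * X c p $ 2 * Y c p $ 2 = 0"
    "g c p $ 1 $ 1 * Y c p $ 1 * Y c p $ 1 + 2 * g c p $ 1 $ 2 * Y c p $ 1 * Y c p $ 2
       + g c p $ 2 $ 2 * Y c p $ 2 * Y c p $ 2 = 1"
    using XX [OF p] XY [OF p] YY [OF p]
    by (simp_all add: metric_in_2 gram_sym [OF p, of 2 1] algebra_simps)
  note gram = gram [OF prem]
  show "(frame_det p)\<^sup>2 * det (g c p) = 1"
    using gram(1) by (simp add: det_gram [OF p] frame_det_def power2_eq_square)
  have "metric_in g c p V (X c p) * X c p $ 1 + metric_in g c p V (Y c p) * Y c p $ 1
      = V $ 1 * ((X c p $ 1 * X c p $ 1 + Y c p $ 1 * Y c p $ 1) * g c p $ 1 $ 1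
          + (X c p $ 1 * X c p $ 2 + Y c p $ 1 * Y c p $ 2) * g c p $ 1 $ 2)
      + V $ 2 * ((X c p $ 1 * X c p $ 1 + Y c p $ 1 * Y c p $ 1) * g c p $ 1 $ 2
          + (X c p $ 1 * X c p $ 2 + Y c p $ 1 * Y c p $ 2) * g c p $ 2 $ 2)"
    "metric_in g c p V (X c p) * X c p $ 2 + metric_in g c p V (Y c p) * Y c p $ 2
      = V $ 1 * ((X c p $ 1 * X c p $ 2 + Y c p $ 1 * Y c p $ 2) * g c p $ 1 $ 1
          + (X c p $ 2 * X c p $ 2 + Y c p $ 2 * Y c p $ 2) * g c p $ 1 $ 2)
      + V $ 2 * ((X c p $ 1 * X c p $ 2 + Y c p $ 1 * Y c p $ 2) * g c p $ 1 $ 2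
          + (X c p $ 2 * X c p $ 2 + Y c p $ 2 * Y c p $ 2) * g c p $ 2 $ 2)"
    by (simp_all add: metric_in_2 gram_sym [OF p, of 2 1] algebra_simps)
  then show "V = metric_in g c p V (X c p) *\<^sub>R X c p + metric_in g c p V (Y c p) *\<^sub>R Y c p"
    unfolding gram by (simp add: vec_eq_iff forall_2)
qed

text \<open>Differentiating the three constant scalar products determines all components in the
  frame: the covariant derivative is skew with respect to (X,Y).\<close>

lemma nabla_frame:
  assumes p: "p \<in> dom_of c"
  shows "nabla_in g c p (axis i 1) X = conn i p *\<^sub>R Y c p"
    and "nabla_in g c p (axis i 1) Y = - (conn i p *\<^sub>R X c p)"
proof -
  have X: "metric_in g c p (nabla_in g c p (axis i 1) X) (X c p) = 0"
    using nabla_metric [of X X, OF C1_nth(1) C1_nth(1) p, of i] pd_const_on [OF XX p, where i = i]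
    by (simp add: metric_commute [OF p])
  have Y: "metric_in g c p (nabla_in g c p (axis i 1) Y) (Y c p) = 0"
    using nabla_metric [of Y Y, OF C1_nth(2) C1_nth(2) p, of i] pd_const_on [OF YY p, where i = i]
    by (simp add: metric_commute [OF p])
  have XY: "metric_in g c p (nabla_in g c p (axis i 1) Y) (X c p) = - conn i p"
    using nabla_metric [of X Y, OF C1_nth p, of i] pd_const_on [OF XY p, where i = i]
    by (simp add: metric_commute [OF p] conn_def)
  show "nabla_in g c p (axis i 1) X = conn i p *\<^sub>R Y c p"
    by (subst frame_gram(2) [OF p]) (simp add: X conn_def)
  show "nabla_in g c p (axis i 1) Y = - (conn i p *\<^sub>R X c p)"
    by (subst frame_gram(2) [OF p]) (simp add: XY Y)
qed

lemma nabla_X: "p \<in> dom_of c \<Longrightarrow>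
    nabla_in g c p V X = (V $ 1 * conn 1 p + V $ 2 * conn 2 p) *\<^sub>R Y c p"
  by (subst nabla_in_expand) (simp add: nabla_frame algebra_simps)

lemma metric_nabla_X: "p \<in> dom_of c \<Longrightarrow>
    metric_in g c p (nabla_in g c p V X) (Y c p) = V $ 1 * conn 1 p + V $ 2 * conn 2 p"
  by (simp add: nabla_X metric_in_linear YY)

text \<open>The connection is torsion-free: the Christoffel terms of
  \<open>\<nabla>\<^sub>X Y\<close> and \<open>\<nabla>\<^sub>Y X\<close> cancel by their symmetry
  in the lower indices.\<close>

lemma lie_bracket_frame:
  assumes p: "p \<in> dom_of c"
  shows "lie_bracket c X Y p =
    - (metric_in g c p (nabla_in g c p (X c p) X) (Y c p) *\<^sub>R X c p)
    - metric_in g c p (nabla_in g c p (Y c p) X) (Y c p) *\<^sub>R Y c p"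
proof -
  have "lie_bracket c X Y p $ k = (X c p $ 1 * nabla_in g c p (axis 1 1) Y $ k + X c p $ 2 * nabla_in g c p (axis 2 1) Y $ k)
     - (Y c p $ 1 * nabla_in g c p (axis 1 1) X $ k + Y c p $ 2 * nabla_in g c p (axis 2 1) X $ k)" for k
    unfolding nabla_axis lie_bracket_def
    by (simp add: sum_2 christoffel_sym [OF p, of k 2 1] algebra_simps)
  then show ?thesis
    by (simp add: vec_eq_iff nabla_frame [OF p] metric_nabla_X [OF p] algebra_simps)
qed

section \<open>Curvature in terms of the connection form\<close>

lemma C1_conn: "Ck_in c 1 (dom_of c) (conn i)"
proof -
  have "Ck_in c 1 (dom_of c) (\<lambda>q. nabla_in g c q (axis i 1) X $ k)" for k
    unfolding nabla_axis sum_2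
    by (intro Ck_in_add Ck_in_mult Ck_christoffel C1_nth C2_pd C2_nth)
  then show ?thesis
    unfolding conn_def [abs_def] metric_in_2 by (intro Ck_in_add Ck_in_mult Ck_gram C1_nth)
qed

text \<open>This is R(\<open>\<partial>\<^sub>1\<close>,\<open>\<partial>\<^sub>2\<close>)U =
  dw(\<open>\<partial>\<^sub>1\<close>,\<open>\<partial>\<^sub>2\<close>) V. It is stated for a
  general pair because it serves both for (X,Y) with w and for (Y,X) with -w.\<close>

lemma riemann_frame:
  assumes U: "\<And>k. Ck_in c 2 (dom_of c) (\<lambda>q. U c q $ k)" and V: "\<And>k. Ck_in c 2 (dom_of c) (\<lambda>q. V c q $ k)"
    and w: "\<And>i. Ck_in c 1 (dom_of c) (w i)"
    and nU: "\<And>i q. q \<in> dom_of c \<Longrightarrow> nabla_in g c q (axis i 1) U = w i q *\<^sub>R V c q"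
    and nV: "\<And>i q. q \<in> dom_of c \<Longrightarrow> nabla_in g c q (axis i 1) V = - (w i q *\<^sub>R U c q)"
    and p: "p \<in> dom_of c"
  shows "(\<Sum>k\<in>UNIV. riemann g c l k 1 2 p * U c p $ k) = (pd c 1 (w 2) p - pd c 2 (w 1) p) * V c p $ l"
proof -
  define \<Gamma> where "\<Gamma> = christoffel g c"
  have C\<Gamma>: "Ck_in c 1 (dom_of c) (\<Gamma> l i j)" for l i j
    unfolding \<Gamma>_def by (rule Ck_christoffel)
  have dU: "pd c i (\<lambda>q. U c q $ k) q = w i q * V c q $ k - (\<Gamma> k i 1 q * U c q $ 1 + \<Gamma> k i 2 q * U c q $ 2)"
    if "q \<in> dom_of c" for i k q
    using nU [OF that, of i] nabla_axis [of g c q i U k] by (simp add: sum_2 \<Gamma>_def)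
  have dV: "pd c i (\<lambda>q. V c q $ k) q = - (w i q * U c q $ k) - (\<Gamma> k i 1 q * V c q $ 1 + \<Gamma> k i 2 q * V c q $ 2)"
    if "q \<in> dom_of c" for i k q
    using nV [OF that, of i] nabla_axis [of g c q i V k] by (simp add: sum_2 \<Gamma>_def)
  \<comment> \<open>The i-th derivative of the component equation for the j-th covariant derivative
    of U. In the difference of the cases (1,2) and (2,1), the second derivatives of U and the
    products of two coefficients of w drop out.\<close>
  have d2: "pd c i (pd c j (\<lambda>q. U c q $ l)) p + (\<Gamma> l j 1 p * pd c i (\<lambda>q. U c q $ 1) p + pd c i (\<Gamma> l j 1) p * U c p $ 1)
      + (\<Gamma> l j 2 p * pd c i (\<lambda>q. U c q $ 2) p + pd c i (\<Gamma> l j 2) p * U c p $ 2)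
      = w j p * pd c i (\<lambda>q. V c q $ l) p + pd c i (w j) p * V c p $ l" for i j
  proof -
    have C: "Ck_in c 1 (dom_of c) (pd c j (\<lambda>q. U c q $ l))" "Ck_in c 1 (dom_of c) (\<lambda>q. \<Gamma> l j m q * U c q $ m)"
      "Ck_in c 1 (dom_of c) (\<lambda>q. U c q $ m)" "Ck_in c 1 (dom_of c) (\<lambda>q. V c q $ m)" for m
      by (intro C2_pd U C2_C1 V Ck_in_mult C\<Gamma>)+
    have "pd c i (\<lambda>q. pd c j (\<lambda>q. U c q $ l) q + \<Gamma> l j 1 q * U c q $ 1 + \<Gamma> l j 2 q * U c q $ 2) p
       = pd c i (\<lambda>q. w j q * V c q $ l) p"
      by (rule pd_cong [OF _ _ p]) (intro Ck_in_add C | simp add: dU)+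
    then show ?thesis
      by (simp add: pd_add [OF _ _ p] pd_mult [OF _ _ p] Ck_in_add C [simplified] C\<Gamma> [simplified] w [simplified])
  qed
  have comm: "pd c 1 (pd c 2 (\<lambda>q. U c q $ l)) p = pd c 2 (pd c 1 (\<lambda>q. U c q $ l)) p"
    by (rule pd_commute [OF U p])
  show ?thesis
    using d2 [of 1 2] d2 [of 2 1] comm
    unfolding dU [OF p] dV [OF p]
    by (simp add: riemann_def sum_2 flip: \<Gamma>_def) (simp add: algebra_simps)
qed

text \<open>The left side is dw(X,Y), written as the coefficient of dw times the coordinate area of
  the frame.\<close>

lemma conn_curl:
  assumes a0: "\<And>q. q \<in> dom_of c \<Longrightarrow> metric_in g c q (nabla_in g c q (X c q) X) (Y c q) = a0"
    and a1: "\<And>q. q \<in> dom_of c \<Longrightarrow> metric_in g c q (nabla_in g c q (Y c q) X) (Y c q) = a1"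
    and p: "p \<in> dom_of c"
  shows "(pd c 1 (conn 2) p - pd c 2 (conn 1) p) * frame_det p = a0\<^sup>2 + a1\<^sup>2"
proof -
  have d0: "X c p $ 1 * pd c j (conn 1) p + pd c j (\<lambda>q. X c q $ 1) p * conn 1 p
      + (X c p $ 2 * pd c j (conn 2) p + pd c j (\<lambda>q. X c q $ 2) p * conn 2 p) = 0"
    and d1: "Y c p $ 1 * pd c j (conn 1) p + pd c j (\<lambda>q. Y c q $ 1) p * conn 1 p
      + (Y c p $ 2 * pd c j (conn 2) p + pd c j (\<lambda>q. Y c q $ 2) p * conn 2 p) = 0" for j
    using pd_const_on [of "\<lambda>q. X c q $ 1 * conn 1 q + X c q $ 2 * conn 2 q" a0 p j]
      pd_const_on [of "\<lambda>q. Y c q $ 1 * conn 1 q + Y c q $ 2 * conn 2 q" a1 p j] a0 a1 p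
    by (simp_all add: metric_nabla_X pd_add [OF _ _ p] pd_mult [OF _ _ p] Ck_in_mult C1_conn [simplified] C1_nth [simplified])
  have lie: "X c p $ 1 * pd c 1 (\<lambda>q. Y c q $ k) p + X c p $ 2 * pd c 2 (\<lambda>q. Y c q $ k) p
     - (Y c p $ 1 * pd c 1 (\<lambda>q. X c q $ k) p + Y c p $ 2 * pd c 2 (\<lambda>q. X c q $ k) p)
     = - (a0 * X c p $ k) - a1 * Y c p $ k" for k
    using arg_cong [OF lie_bracket_frame [OF p], of "\<lambda>v. v $ k"] a0 [OF p] a1 [OF p]
    by (simp add: lie_bracket_def sum_2 algebra_simps)
  have e0: "X c p $ 1 * conn 1 p + X c p $ 2 * conn 2 p = a0" and e1: "Y c p $ 1 * conn 1 p + Y c p $ 2 * conn 2 p = a1"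
    using a0 [OF p] a1 [OF p] by (simp_all add: metric_nabla_X [OF p])
  define l1 l2 where "l1 = - (a0 * X c p $ 1) - a1 * Y c p $ 1" and "l2 = - (a0 * X c p $ 2) - a1 * Y c p $ 2"
  have "(pd c 1 (conn 2) p - pd c 2 (conn 1) p) * frame_det p = - (conn 1 p * l1 + conn 2 p * l2)"
  proof -
    \<comment> \<open>The zeros are the derivatives of the constants w(Y) and w(X). Written out by
      \<open>d1\<close> and \<open>d0\<close>, the line is the identity X(w(Y)) - Y(w(X)) = dw(X,Y)
      + w([X,Y]), where \<open>l1\<close> and \<open>l2\<close> are the components of the
      bracket.\<close>
    have "X c p $ 1 * 0 + X c p $ 2 * 0 - (Y c p $ 1 * 0 + Y c p $ 2 * (0::real))
      = (pd c 1 (conn 2) p - pd c 2 (conn 1) p) * frame_det p + (conn 1 p * l1 + conn 2 p * l2)"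
      unfolding l1_def l2_def lie [symmetric]
      by (subst d1 [of 1, symmetric], subst d1 [of 2, symmetric],
          subst d0 [of 1, symmetric], subst d0 [of 2, symmetric])
         (simp add: frame_det_def algebra_simps)
    then show ?thesis by simp
  qed
  also have "\<dots> = a0 * (X c p $ 1 * conn 1 p + X c p $ 2 * conn 2 p) + a1 * (Y c p $ 1 * conn 1 p + Y c p $ 2 * conn 2 p)"
    by (simp add: l1_def l2_def algebra_simps)
  finally show ?thesis by (simp add: e0 e1 power2_eq_square)
qed

text \<open>R(\<open>\<partial>\<^sub>1\<close>,\<open>\<partial>\<^sub>2\<close>) is known on X and
  Y, whereas the definition of the curvature applies it to \<open>\<partial>\<^sub>2\<close>; the
  proof changes basis and normalizes the area by \<open>frame_det\<close>.\<close>

lemma curvature_frame: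
  assumes a0: "\<And>q. q \<in> dom_of c \<Longrightarrow> metric_in g c q (nabla_in g c q (X c q) X) (Y c q) = a0"
    and a1: "\<And>q. q \<in> dom_of c \<Longrightarrow> metric_in g c q (nabla_in g c q (Y c q) X) (Y c q) = a1"
    and p: "p \<in> dom_of c"
  shows "metric_in g c p (\<chi> l. riemann g c l 2 1 2 p) (axis 1 1) / det (g c p) = - (a0\<^sup>2 + a1\<^sup>2)"
proof -
  define \<kappa> where "\<kappa> = pd c 1 (conn 2) p - pd c 2 (conn 1) p"
  define R where "R = (\<chi> l. riemann g c l 2 1 2 p)"
  have rX: "riemann g c l 1 1 2 p * X c p $ 1 + R $ l * X c p $ 2 = \<kappa> * Y c p $ l" for l
    using riemann_frame [of X Y conn p l, OF C2_nth C1_conn nabla_frame p]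
    by (simp add: sum_2 \<kappa>_def R_def)
  have neg: "pd c i (\<lambda>q. - conn j q) p = - pd c i (conn j) p" for i j
    by (rule pd_bounded_linear [OF bounded_linear_minus [OF bounded_linear_ident] C1_conn p])
  \<comment> \<open>Exchanging X and Y reverses the sign of the connection form.\<close>
  have rY: "riemann g c l 1 1 2 p * Y c p $ 1 + R $ l * Y c p $ 2 = - \<kappa> * X c p $ l" for l
    using riemann_frame [of Y X "\<lambda>i q. - conn i q" p l, OF C2_nth(2,1) Ck_in_uminus [OF C1_conn] _ _ p]
    by (simp add: sum_2 \<kappa>_def R_def nabla_frame neg)
  have R: "frame_det p *\<^sub>R R = (- \<kappa>) *\<^sub>R (X c p $ 1 *\<^sub>R X c p + Y c p $ 1 *\<^sub>R Y c p)"
  proof -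
    \<comment> \<open>The combination \<open>X\<^sup>1 Y - Y\<^sup>1 X\<close> equals
      \<open>frame_det p\<close> times \<open>\<partial>\<^sub>2\<close>, since its first component
      cancels.\<close>
    have "frame_det p * R $ l = X c p $ 1 * (riemann g c l 1 1 2 p * Y c p $ 1 + R $ l * Y c p $ 2)
       - Y c p $ 1 * (riemann g c l 1 1 2 p * X c p $ 1 + R $ l * X c p $ 2)" for l
      by (simp add: frame_det_def algebra_simps)
    then show ?thesis
      unfolding rX rY by (simp add: vec_eq_iff algebra_simps)
  qed
  \<comment> \<open>Pairing with \<open>\<partial>\<^sub>1\<close> produces the first component of
    the frame expansion of \<open>\<partial>\<^sub>1\<close>, which is 1.\<close>
  have "frame_det p * metric_in g c p R (axis 1 1)
      = - \<kappa> * (metric_in g c p (axis 1 1) (X c p) *\<^sub>R X c p + metric_in g c p (axis 1 1) (Y c p) *\<^sub>R Y c p) $ 1"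
    unfolding metric_in_linear(3) [symmetric] R
    unfolding metric_in_linear(1,3) metric_commute [OF p, of "X c p" "axis 1 1"]
      metric_commute [OF p, of "Y c p" "axis 1 1"]
    by (simp add: algebra_simps)
  also have "\<dots> = - \<kappa>"
    by (subst frame_gram(2) [OF p, symmetric]) (simp add: axis_def)
  finally have "frame_det p * (frame_det p * metric_in g c p R (axis 1 1)) = - (a0\<^sup>2 + a1\<^sup>2)"
    using conn_curl [OF a0 a1 p] by (simp add: \<kappa>_def [symmetric] mult.commute)
  moreover have "inverse (det (g c p)) = (frame_det p)\<^sup>2"
    using frame_gram(1) [OF p] by (metis inverse_unique mult.commute)
  ultimately show ?thesis
    by (simp add: R_def divide_inverse power2_eq_square algebra_simps)
qed

section \<open>The norm of the covariant derivative of X\<close>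

lemma metric_frame:
  assumes p: "p \<in> dom_of c"
  shows "metric_in g c p u v = metric_in g c p u (X c p) * metric_in g c p v (X c p)
    + metric_in g c p u (Y c p) * metric_in g c p v (Y c p)"
proof -
  have "metric_in g c p u v = metric_in g c p u
      (metric_in g c p v (X c p) *\<^sub>R X c p + metric_in g c p v (Y c p) *\<^sub>R Y c p)"
    by (rule arg_cong [OF frame_gram(2) [OF p], of "metric_in g c p u"])
  then show ?thesis
    by (simp only: metric_in_linear mult.commute)
qed

text \<open>Both sides are the squared norm of the covector w, computed in two orthonormal bases.
  This makes the arbitrary basis in \<open>sasaki_density\<close> harmless.\<close>

lemma nabla_X_norm:
  assumes p: "p \<in> dom_of c"
    and u: "metric_in g c p u u = 1" "metric_in g c p u v = 0" "metric_in g c p v v = 1"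
  shows "metric_in g c p (nabla_in g c p u X) (nabla_in g c p u X)
      + metric_in g c p (nabla_in g c p v X) (nabla_in g c p v X)
    = (metric_in g c p (nabla_in g c p (X c p) X) (Y c p))\<^sup>2
      + (metric_in g c p (nabla_in g c p (Y c p) X) (Y c p))\<^sup>2"
proof -
  define w where "w V = V $ 1 * conn 1 p + V $ 2 * conn 2 p" for V :: "real^2"
  have w_frame: "w V = metric_in g c p V (X c p) * w (X c p) + metric_in g c p V (Y c p) * w (Y c p)" for V
  proof -
    have "w V = w (metric_in g c p V (X c p) *\<^sub>R X c p + metric_in g c p V (Y c p) *\<^sub>R Y c p)"
      by (rule arg_cong [OF frame_gram(2) [OF p], of w])
    then show ?thesis by (simp add: w_def algebra_simps)
  qed
  define a b a' b' where "a = metric_in g c p u (X c p)" and "b = metric_in g c p u (Y c p)"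
    and "a' = metric_in g c p v (X c p)" and "b' = metric_in g c p v (Y c p)"
  have "a * a + b * b = 1" "a * a' + b * b' = 0" "a' * a' + b' * b' = 1"
    using u by (simp_all add: metric_frame [OF p, of u u] metric_frame [OF p, of u v]
        metric_frame [OF p, of v v] a_def b_def a'_def b'_def)
  \<comment> \<open>The rows of the change of basis are orthonormal, hence so are its columns:
    \<open>gram_inverse\<close> with the identity as Gram matrix.\<close>
  then have orth: "a * a + a' * a' = 1" "a * b + a' * b' = 0" "b * b + b' * b' = 1"
    using gram_inverse [of 1 a 0 b 1 a' b'] by simp_all
  have "w u * w u + w v * w v = (a * a + a' * a') * (w (X c p))\<^sup>2
     + 2 * (a * b + a' * b') * w (X c p) * w (Y c p) + (b * b + b' * b') * (w (Y c p))\<^sup>2"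
    unfolding w_frame [of u] w_frame [of v] a_def b_def a'_def b'_def
    by (simp add: algebra_simps power2_eq_square)
  then show ?thesis
    unfolding orth by (simp add: nabla_X [OF p] metric_in_linear YY [OF p] w_def)
qed

end

section \<open>Change of charts\<close>

lemma frechet_derivative_partial:
  assumes "f differentiable (at x)"
  shows "frechet_derivative f (at x) v = v $ 1 *\<^sub>R partial 1 f x + v $ 2 *\<^sub>R partial 2 f x"
proof -
  interpret bounded_linear "frechet_derivative f (at x)"
    using has_derivative_partial [OF assms] by (rule has_derivative_bounded_linear)
  have "v = v $ 1 *\<^sub>R axis 1 1 + v $ 2 *\<^sub>R axis 2 1"
    by (simp add: vec_eq_iff forall_2 axis_def)
  then have "frechet_derivative f (at x) v = frechet_derivative f (at x) (v $ 1 *\<^sub>R axis 1 1 + v $ 2 *\<^sub>R axis 2 1)"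
    by (rule arg_cong)
  then show ?thesis by (simp add: partial_def add scale)
qed

lemma jac_pd:
  assumes "(coord d \<circ> param c) differentiable (at (coord c p))"
  shows "jac c d p $ k $ i = pd c i (coord d) p $ k"
  by (simp add: jac_def jacobian_def transition_def matrix_def pd_def partial_def)

lemma pd_chain:
  assumes c: "is_chart c" and d: "is_chart d" and p: "p \<in> dom_of c" "p \<in> dom_of d"
    and T: "(coord d \<circ> param c) differentiable (at (coord c p))"
    and f: "(f \<circ> param d) differentiable (at (coord d p))"
  shows "pd c i f p = (jac c d p $ 1 $ i) *\<^sub>R pd d 1 f p + (jac c d p $ 2 $ i) *\<^sub>R pd d 2 f p"
proof -
  interpret chart_region c "dom_of c \<inter> dom_of d"
    using c d by unfold_locales (auto simp: is_chart_def)
  have pc: "param c (coord c p) = p" using p by (simp add: param_coord)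
  have pd: "param d (coord d q) = q" if "q \<in> dom_of d" for q
    using d that by (auto simp: is_chart_def homeomorphism_def)
  have "((f \<circ> param d) has_derivative frechet_derivative (f \<circ> param d) (at (coord d p)))
      (at ((coord d \<circ> param c) (coord c p)))"
    using has_derivative_partial [OF f] by (simp add: pc)
  from diff_chain_at [OF has_derivative_partial [OF T] this]
  have chain: "((f \<circ> param d) \<circ> (coord d \<circ> param c) has_derivative
      (\<lambda>v. frechet_derivative (f \<circ> param d) (at (coord d p))
        (frechet_derivative (coord d \<circ> param c) (at (coord c p)) v))) (at (coord c p))"
    by (simp add: comp_def)
  \<comment> \<open>The factorization through the chart d holds over the overlap, whose image is an
    open set around the point.\<close>
  have "((f \<circ> param c) has_derivative
      (\<lambda>v. frechet_derivative (f \<circ> param d) (at (coord d p))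
        (frechet_derivative (coord d \<circ> param c) (at (coord c p)) v))) (at (coord c p))"
    by (rule has_derivative_transform_within_open [OF chain open_image])
       (use p pd param_coord in auto)
  from partial_eqI [OF this, of i]
  show ?thesis
    by (simp add: frechet_derivative_partial [OF f] jac_pd [OF T]) (simp add: pd_def partial_def)
qed

lemma metric_in_jac:
  assumes "g c p = transpose J ** g d p ** J"
  shows "metric_in g c p v w = metric_in g d p (J *v v) (J *v w)"
  unfolding metric_in_2 assms
  by (simp add: matrix_matrix_mult_def matrix_vector_mult_def transpose_def sum_2 algebra_simps)

text \<open>A quarter turn in coordinates: v is an algebraic expression in u, the Gram matrix and
  the root of its determinant. This is what gives Y the regularity of X.\<close>

lemma (in metric_chart) direct_frame_eq:
  assumes p: "p \<in> dom_of c"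
    and orth: "metric_in g c p u u = 1" "metric_in g c p u v = 0" "metric_in g c p v v = 1"
    and pos: "u $ 1 * v $ 2 - u $ 2 * v $ 1 > 0"
  shows "v $ 1 = - 1 * (g c p $ 2 $ 1 * u $ 1 + g c p $ 2 $ 2 * u $ 2) * inverse (sqrt (det (g c p)))"
    and "v $ 2 = (g c p $ 1 $ 1 * u $ 1 + g c p $ 1 $ 2 * u $ 2) * inverse (sqrt (det (g c p)))"
proof -
  let ?D = "u $ 1 * v $ 2 - u $ 2 * v $ 1"
  \<comment> \<open>The components of the covector dual to u. It takes the value 1 on u and 0 on v,
    which fixes it up to the area \<open>?D\<close>.\<close>
  define \<xi> \<eta> where "\<xi> = g c p $ 1 $ 1 * u $ 1 + g c p $ 1 $ 2 * u $ 2"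
    and "\<eta> = g c p $ 2 $ 1 * u $ 1 + g c p $ 2 $ 2 * u $ 2"
  have "?D\<^sup>2 * det (g c p) = 1"
    unfolding det_gram [OF p] power2_eq_square [of "g c p $ 1 $ 2"]
    by (rule gram_inverse(1))
       (use orth in \<open>simp_all add: metric_in_2 gram_sym [OF p, of 2 1] algebra_simps\<close>)
  then have "sqrt (?D\<^sup>2 * det (g c p)) = 1" by simp
  then have "?D * sqrt (det (g c p)) = 1"
    using pos by (simp add: real_sqrt_mult)
  then have D: "inverse (sqrt (det (g c p))) = ?D"
    by (metis inverse_unique mult.commute)
  have 1: "\<xi> * u $ 1 + \<eta> * u $ 2 = 1" "\<xi> * v $ 1 + \<eta> * v $ 2 = 0"
    using orth by (simp_all add: metric_in_2 gram_sym [OF p, of 2 1] \<xi>_def \<eta>_def algebra_simps)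
  have "- 1 * \<eta> * ?D = v $ 1 * (\<xi> * u $ 1 + \<eta> * u $ 2) - u $ 1 * (\<xi> * v $ 1 + \<eta> * v $ 2)"
    "\<xi> * ?D = v $ 2 * (\<xi> * u $ 1 + \<eta> * u $ 2) - u $ 2 * (\<xi> * v $ 1 + \<eta> * v $ 2)"
    by (simp_all add: algebra_simps)
  then show "v $ 1 = - 1 * (g c p $ 2 $ 1 * u $ 1 + g c p $ 2 $ 2 * u $ 2) * inverse (sqrt (det (g c p)))"
    "v $ 2 = (g c p $ 1 $ 1 * u $ 1 + g c p $ 1 $ 2 * u $ 2) * inverse (sqrt (det (g c p)))"
    unfolding D by (simp_all flip: \<xi>_def \<eta>_def add: 1)
qed

section \<open>A direct orthonormal frame on the whole surface\<close>

locale oriented_frame =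
  fixes \<A> :: "'a::{t2_space,second_countable_topology} chart set"
    and g :: "'a gram" and X Y :: "'a vfield"
  assumes surface: "oriented_surface \<A>" and metric: "riemannian_metric \<A> g"
    and C2_field: "Ck_vector_field 2 \<A> X" and frame: "direct_orthonormal_frame \<A> g X Y"
begin

lemma chart_at: "chart_at \<A> p \<in> \<A>" "p \<in> dom_of (chart_at \<A> p)"
proof -
  have "p \<in> (\<Union>c\<in>\<A>. dom_of c)" using surface by (simp add: oriented_surface_def)
  then have "\<exists>c. c \<in> \<A> \<and> p \<in> dom_of c" by auto
  then have "chart_at \<A> p \<in> \<A> \<and> p \<in> dom_of (chart_at \<A> p)"
    unfolding chart_at_def by (rule someI_ex)
  then show "chart_at \<A> p \<in> \<A>" "p \<in> dom_of (chart_at \<A> p)" by auto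
qed

lemma is_chart: "c \<in> \<A> \<Longrightarrow> is_chart c"
  using surface by (simp add: oriented_surface_def)

lemma metric_jac:
  assumes "c \<in> \<A>" "d \<in> \<A>" "p \<in> dom_of c" "p \<in> dom_of d"
  shows "metric_in g c p v w = metric_in g d p (jac c d p *v v) (jac c d p *v w)"
proof (rule metric_in_jac)
  show "g c p = transpose (jac c d p) ** g d p ** jac c d p"
    using metric assms unfolding riemannian_metric_def by blast
qed

lemma field_jac:
  assumes "c \<in> \<A>" "d \<in> \<A>" "p \<in> dom_of c" "p \<in> dom_of d"
  shows "X d p = jac c d p *v X c p" "Y d p = jac c d p *v Y c p"
  using frame assms unfolding direct_orthonormal_frame_def vector_field_def by blast+

lemma orthonormal:
  assumes c: "c \<in> \<A>" "p \<in> dom_of c"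
  shows "metric_in g c p (X c p) (X c p) = 1" "metric_in g c p (X c p) (Y c p) = 0"
    "metric_in g c p (Y c p) (Y c p) = 1"
  unfolding metric_jac [OF c(1) chart_at(1) c(2) chart_at(2)]
    field_jac [OF c(1) chart_at(1) c(2) chart_at(2), symmetric]
  using frame unfolding direct_orthonormal_frame_def riem_inner_def Let_def by blast+

lemma metric_chart:
  assumes "c \<in> \<A>"
  shows "metric_chart c g"
proof
  show "is_chart c" "open (dom_of c)" "dom_of c \<subseteq> dom_of c"
    using is_chart [OF assms] by (auto simp: is_chart_def)
  show "smooth_on (coord c ` dom_of c) (g c \<circ> param c)"
    using metric assms unfolding riemannian_metric_def by blast
  show "g c p $ i $ j = g c p $ j $ i" if "p \<in> dom_of c" for p i j
  proof -
    have "transpose (g c p) = g c p"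
      using metric assms that unfolding riemannian_metric_def by blast
    then have "transpose (g c p) $ i $ j = g c p $ i $ j" by simp
    then show ?thesis by (simp add: transpose_def)
  qed
  show "metric_in g c p v v > 0" if "p \<in> dom_of c" "v \<noteq> 0" for p v
    using metric assms that unfolding riemannian_metric_def metric_in_def by blast
qed

lemma frame_chart:
  assumes c: "c \<in> \<A>"
  shows "frame_chart c g X Y"
proof -
  interpret metric_chart c g by (rule metric_chart [OF c])
  have X: "Ck_in c 2 (dom_of c) (\<lambda>q. X c q $ k)" for k
    using C2_field c by (intro Ck_in_nth) (auto simp: Ck_vector_field_def Ck_in_def)
  have pos: "X c q $ 1 * Y c q $ 2 - X c q $ 2 * Y c q $ 1 > 0" if "q \<in> dom_of c" for q
    using frame c that by (auto simp: direct_orthonormal_frame_def det_2)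
  note Y = direct_frame_eq [OF _ orthonormal [OF c] pos]
  have C: "Ck_in c 2 (dom_of c) (\<lambda>q. inverse (sqrt (det (g c q))))"
    using det_pos by (intro Ck_in_inverse Ck_in_sqrt Ck_det) force+
  have "Ck_in c 2 (dom_of c) (\<lambda>q. Y c q $ 1)"
    by (rule Ck_in_cong [where f = "\<lambda>p. - 1 * (g c p $ 2 $ 1 * X c p $ 1 + g c p $ 2 $ 2 * X c p $ 2)
        * inverse (sqrt (det (g c p)))"])
       (intro Ck_in_mult Ck_in_add Ck_in_const Ck_gram X C, simp add: Y(1))
  moreover have "Ck_in c 2 (dom_of c) (\<lambda>q. Y c q $ 2)"
    by (rule Ck_in_cong [where f = "\<lambda>p. (g c p $ 1 $ 1 * X c p $ 1 + g c p $ 1 $ 2 * X c p $ 2)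
        * inverse (sqrt (det (g c p)))"])
       (intro Ck_in_mult Ck_in_add Ck_in_const Ck_gram X C, simp add: Y(2))
  ultimately have "Ck_in c 2 (dom_of c) (\<lambda>q. Y c q $ k)" for k
    using exhaust_2 [of k] by auto
  then show ?thesis
    using X orthonormal [OF c] by unfold_locales auto
qed

text \<open>Second derivatives of the transition map enter the derivatives of X and of Y with the
  same symmetric coefficients, so they cancel in the bracket and only the Jacobian remains.\<close>

lemma lie_bracket_jac:
  assumes c: "c \<in> \<A>" and d: "d \<in> \<A>" and p: "p \<in> dom_of c" "p \<in> dom_of d"
  shows "lie_bracket d X Y p = jac c d p *v lie_bracket c X Y p"
proof -
  interpret C: frame_chart c g X Y by (rule frame_chart [OF c])
  interpret D: frame_chart d g X Y by (rule frame_chart [OF d])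
  interpret W: chart_region c "dom_of c \<inter> dom_of d"
    using C.chart C.open_W D.open_W by unfold_locales auto
  have pW: "p \<in> dom_of c \<inter> dom_of d" using p by simp
  have mono: "Ck_in c k (dom_of c \<inter> dom_of d) f" if "Ck_in c k (dom_of c) f" for k and f :: "'a \<Rightarrow> real"
    using that unfolding Ck_in_def by (rule Ck_on_mono) auto
  have T: "Ck_in c k (dom_of c \<inter> dom_of d) (coord d)" for k
  proof -
    have "smooth_on (transition_dom c d) (transition c d)"
      using surface c d by (auto simp: oriented_surface_def compatible_def)
    then show ?thesis
      by (simp add: Ck_in_def smooth_on_def transition_dom_def transition_def)
  qed
  have CT: "Ck_in c m (dom_of c \<inter> dom_of d) (\<lambda>q. coord d q $ k)" for m k
    by (rule W.Ck_in_nth [OF T])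
  have Td: "(coord d \<circ> param c) differentiable (at (coord c q))" if "q \<in> dom_of c \<inter> dom_of d" for q
    by (rule W.C1_differentiable [OF T that])
  have J: "jac c d q $ k $ i = pd c i (\<lambda>q. coord d q $ k) q" if "q \<in> dom_of c \<inter> dom_of d" for q k i
    using jac_pd [OF Td [OF that]] W.pd_bounded_linear [OF bounded_linear_vec_nth T that, of i k] by simp
  have chain: "pd c j f p = jac c d p $ 1 $ j * pd d 1 f p + jac c d p $ 2 $ j * pd d 2 f p"
    if "Ck_in d 1 (dom_of d) f" for f :: "'a \<Rightarrow> real" and j
    using pd_chain [OF C.chart D.chart p Td [OF pW] D.C1_differentiable [OF that p(2)]] by simp
  \<comment> \<open>The j-th derivative in chart c of a component taken in chart d, computed twice:
    by the chain rule on the left, and by the product rule applied to the Jacobian times V on the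
    right.\<close>
  have field: "jac c d p $ 1 $ j * pd d 1 (\<lambda>q. V d q $ k) p + jac c d p $ 2 $ j * pd d 2 (\<lambda>q. V d q $ k) p
     = pd c 1 (\<lambda>q. coord d q $ k) p * pd c j (\<lambda>q. V c q $ 1) p + pd c j (pd c 1 (\<lambda>q. coord d q $ k)) p * V c p $ 1
     + (pd c 2 (\<lambda>q. coord d q $ k) p * pd c j (\<lambda>q. V c q $ 2) p + pd c j (pd c 2 (\<lambda>q. coord d q $ k)) p * V c p $ 2)"
    if Vd: "\<And>k. Ck_in d 1 (dom_of d) (\<lambda>q. V d q $ k)" and Vc: "\<And>k. Ck_in c 1 (dom_of c) (\<lambda>q. V c q $ k)"
      and V: "\<And>q. q \<in> dom_of c \<inter> dom_of d \<Longrightarrow> V d q = jac c d q *v V c q" for V :: "'a vfield" and j k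
  proof -
    have CV: "Ck_in c 1 (dom_of c \<inter> dom_of d) (\<lambda>q. pd c m (\<lambda>q. coord d q $ k) q * V c q $ m)"
      "Ck_in c 1 (dom_of c \<inter> dom_of d) (pd c m (\<lambda>q. coord d q $ k))"
      "Ck_in c 1 (dom_of c \<inter> dom_of d) (\<lambda>q. V c q $ m)" for m
      by (intro W.Ck_in_mult W.Ck_in_pd CT mono Vc)+
    have "pd c j (\<lambda>q. V d q $ k) p = pd c j (\<lambda>q. pd c 1 (\<lambda>q. coord d q $ k) q * V c q $ 1
        + pd c 2 (\<lambda>q. coord d q $ k) q * V c q $ 2) p"
      by (rule W.pd_cong [symmetric, OF _ _ pW])
         (intro W.Ck_in_add CV, simp add: V J matrix_vector_mult_def sum_2)
    also have "\<dots> = pd c 1 (\<lambda>q. coord d q $ k) p * pd c j (\<lambda>q. V c q $ 1) p + pd c j (pd c 1 (\<lambda>q. coord d q $ k)) p * V c p $ 1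
     + (pd c 2 (\<lambda>q. coord d q $ k) p * pd c j (\<lambda>q. V c q $ 2) p + pd c j (pd c 2 (\<lambda>q. coord d q $ k)) p * V c p $ 2)"
      unfolding W.pd_add [OF CV(1) CV(1) pW] W.pd_mult [OF CV(2,3) pW] ..
    finally show ?thesis
      unfolding chain [OF Vd] .
  qed
  have comm: "pd c 2 (pd c 1 (\<lambda>q. coord d q $ k)) p = pd c 1 (pd c 2 (\<lambda>q. coord d q $ k)) p" for k
    by (rule W.pd_commute [OF CT pW])
  have FX: "jac c d p $ 1 $ j * pd d 1 (\<lambda>q. X d q $ k) p + jac c d p $ 2 $ j * pd d 2 (\<lambda>q. X d q $ k) p
     = pd c 1 (\<lambda>q. coord d q $ k) p * pd c j (\<lambda>q. X c q $ 1) p + pd c j (pd c 1 (\<lambda>q. coord d q $ k)) p * X c p $ 1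
     + (pd c 2 (\<lambda>q. coord d q $ k) p * pd c j (\<lambda>q. X c q $ 2) p + pd c j (pd c 2 (\<lambda>q. coord d q $ k)) p * X c p $ 2)"
    and FY: "jac c d p $ 1 $ j * pd d 1 (\<lambda>q. Y d q $ k) p + jac c d p $ 2 $ j * pd d 2 (\<lambda>q. Y d q $ k) p
     = pd c 1 (\<lambda>q. coord d q $ k) p * pd c j (\<lambda>q. Y c q $ 1) p + pd c j (pd c 1 (\<lambda>q. coord d q $ k)) p * Y c p $ 1
     + (pd c 2 (\<lambda>q. coord d q $ k) p * pd c j (\<lambda>q. Y c q $ 2) p + pd c j (pd c 2 (\<lambda>q. coord d q $ k)) p * Y c p $ 2)" for j k
    using field_jac [OF c d] by (intro field D.C1_nth C.C1_nth; blast)+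
  have "lie_bracket d X Y p $ k =
      X c p $ 1 * (jac c d p $ 1 $ 1 * pd d 1 (\<lambda>q. Y d q $ k) p + jac c d p $ 2 $ 1 * pd d 2 (\<lambda>q. Y d q $ k) p)
    + X c p $ 2 * (jac c d p $ 1 $ 2 * pd d 1 (\<lambda>q. Y d q $ k) p + jac c d p $ 2 $ 2 * pd d 2 (\<lambda>q. Y d q $ k) p)
    - Y c p $ 1 * (jac c d p $ 1 $ 1 * pd d 1 (\<lambda>q. X d q $ k) p + jac c d p $ 2 $ 1 * pd d 2 (\<lambda>q. X d q $ k) p)
    - Y c p $ 2 * (jac c d p $ 1 $ 2 * pd d 1 (\<lambda>q. X d q $ k) p + jac c d p $ 2 $ 2 * pd d 2 (\<lambda>q. X d q $ k) p)" for k
    by (simp add: lie_bracket_def sum_2 field_jac [OF c d p] matrix_vector_mult_def algebra_simps)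
  also have "\<dots> k = (jac c d p *v lie_bracket c X Y p) $ k" for k
    unfolding FX FY comm
    by (simp add: lie_bracket_def sum_2 matrix_vector_mult_def J [OF pW] algebra_simps)
  finally show ?thesis by (simp add: vec_eq_iff)
qed

end

section \<open>Constancy of the invariants\<close>

lemma Ck_on_1_zero_constant:
  assumes "open U" "u \<in> U" "Ck_on 1 U f" "\<And>x i. x \<in> U \<Longrightarrow> partial i f x = 0"
  shows "\<exists>e>0. ball u e \<subseteq> U \<and> (\<forall>x\<in>ball u e. f x = f u)"
proof -
  obtain e where e: "e > 0" "ball u e \<subseteq> U"
    using assms openE by blast
  have "(f has_derivative (\<lambda>v. 0)) (at x within ball u e)" if "x \<in> ball u e" for x
  proof -
    have "x \<in> U" using that e by auto
    then have "f differentiable (at x)" using assms(3) by simp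
    moreover from this have "frechet_derivative f (at x) = (\<lambda>v. 0)"
      using assms(4) [OF \<open>x \<in> U\<close>] by (simp add: fun_eq_iff frechet_derivative_partial)
    ultimately have "(f has_derivative (\<lambda>v. 0)) (at x)"
      using has_derivative_partial by metis
    then show ?thesis by (rule has_derivative_at_withinI)
  qed
  then obtain a where "\<And>x. x \<in> ball u e \<Longrightarrow> f x = a"
    using has_derivative_zero_constant [of "ball u e" f] by auto
  with e show ?thesis by (metis centre_in_ball)
qed

section \<open>The invariants read in an arbitrary chart\<close>

context oriented_frame
begin

text \<open>It replaces the chart picked at p by any fixed chart around p, so that the functions can
  be differentiated. In both charts the values are minus the scalar products of the bracket with X
  and Y, and all three vectors transform by the same Jacobian.\<close>

lemma riem_inner_nabla:
  assumes c: "c \<in> \<A>" "p \<in> dom_of c"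
  shows "riem_inner \<A> g (nabla g X X) Y p = metric_in g c p (nabla_in g c p (X c p) X) (Y c p)"
    and "riem_inner \<A> g (nabla g Y X) Y p = metric_in g c p (nabla_in g c p (Y c p) X) (Y c p)"
proof -
  have bracket: "metric_in g d p (X d p) (lie_bracket d X Y p)
        = - metric_in g d p (nabla_in g d p (X d p) X) (Y d p)"
    "metric_in g d p (Y d p) (lie_bracket d X Y p)
        = - metric_in g d p (nabla_in g d p (Y d p) X) (Y d p)" if d: "d \<in> \<A>" "p \<in> dom_of d" for d
  proof -
    interpret frame_chart d g X Y by (rule frame_chart [OF d(1)])
    have "metric_in g d p V (lie_bracket d X Y p)
        = - (metric_in g d p (nabla_in g d p (X d p) X) (Y d p) * metric_in g d p V (X d p))
          - metric_in g d p (nabla_in g d p (Y d p) X) (Y d p) * metric_in g d p V (Y d p)" for V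
      unfolding lie_bracket_frame [OF d(2)] diff_conv_add_uminus metric_in_linear ..
    then show "metric_in g d p (X d p) (lie_bracket d X Y p)
        = - metric_in g d p (nabla_in g d p (X d p) X) (Y d p)"
      "metric_in g d p (Y d p) (lie_bracket d X Y p)
        = - metric_in g d p (nabla_in g d p (Y d p) X) (Y d p)"
      using metric_commute [OF d(2), of "Y d p" "X d p"] by (simp_all add: XX XY YY d)
  qed
  note jac = metric_jac [OF c(1) chart_at(1) c(2) chart_at(2)]
    field_jac [OF c(1) chart_at(1) c(2) chart_at(2)] lie_bracket_jac [OF c(1) chart_at(1) c(2) chart_at(2)]
  have "metric_in g c p (X c p) (lie_bracket c X Y p)
      = metric_in g (chart_at \<A> p) p (X (chart_at \<A> p) p) (lie_bracket (chart_at \<A> p) X Y p)"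
    unfolding jac(2,4) by (rule jac(1))
  then show "riem_inner \<A> g (nabla g X X) Y p = metric_in g c p (nabla_in g c p (X c p) X) (Y c p)"
    using bracket [OF c] bracket [OF chart_at] by (simp add: riem_inner_def nabla_def Let_def)
  have "metric_in g c p (Y c p) (lie_bracket c X Y p)
      = metric_in g (chart_at \<A> p) p (Y (chart_at \<A> p) p) (lie_bracket (chart_at \<A> p) X Y p)"
    unfolding jac(3,4) by (rule jac(1))
  then show "riem_inner \<A> g (nabla g Y X) Y p = metric_in g c p (nabla_in g c p (Y c p) X) (Y c p)"
    using bracket [OF c] bracket [OF chart_at] by (simp add: riem_inner_def nabla_def Let_def)
qed

lemma C1_riem_inner_nabla:
  assumes c: "c \<in> \<A>"
  shows "Ck_in c 1 (dom_of c) (riem_inner \<A> g (nabla g X X) Y)"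
    and "Ck_in c 1 (dom_of c) (riem_inner \<A> g (nabla g Y X) Y)"
proof -
  interpret frame_chart c g X Y by (rule frame_chart [OF c])
  show "Ck_in c 1 (dom_of c) (riem_inner \<A> g (nabla g X X) Y)"
    by (rule Ck_in_cong [where f = "\<lambda>q. X c q $ 1 * conn 1 q + X c q $ 2 * conn 2 q"])
       (intro Ck_in_add Ck_in_mult C1_nth C1_conn, simp add: riem_inner_nabla [OF c] metric_nabla_X)
  show "Ck_in c 1 (dom_of c) (riem_inner \<A> g (nabla g Y X) Y)"
    by (rule Ck_in_cong [where f = "\<lambda>q. Y c q $ 1 * conn 1 q + Y c q $ 2 * conn 2 q"])
       (intro Ck_in_add Ck_in_mult C1_nth C1_conn, simp add: riem_inner_nabla [OF c] metric_nabla_X)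
qed

lemma sasaki_density_eq:
  "sasaki_density \<A> g X p = sqrt (1 + ((riem_inner \<A> g (nabla g X X) Y p)\<^sup>2 + (riem_inner \<A> g (nabla g Y X) Y p)\<^sup>2))"
proof -
  define c where "c = chart_at \<A> p"
  have c: "c \<in> \<A>" "p \<in> dom_of c" by (simp_all add: c_def chart_at)
  interpret frame_chart c g X Y by (rule frame_chart [OF c(1)])
  let ?P = "\<lambda>(u, v). metric_in g c p u u = 1 \<and> metric_in g c p u v = 0 \<and> metric_in g c p v v = 1"
  obtain u v where uv: "Eps ?P = (u, v)" by fastforce
  \<comment> \<open>The frame itself shows that an orthonormal basis exists to be chosen.\<close>
  have "?P (X c p, Y c p)" using c by (simp add: XX XY YY)
  then have "?P (Eps ?P)" by (rule someI)
  then have "metric_in g c p u u = 1" "metric_in g c p u v = 0" "metric_in g c p v v = 1"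
    unfolding uv by auto
  from nabla_X_norm [OF c(2) this]
  show ?thesis
    unfolding sasaki_density_def Let_def c_def [symmetric] uv riem_inner_nabla [OF c]
    by (simp add: add.assoc)
qed

lemma gauss_curvature_eq:
  assumes "\<And>q. riem_inner \<A> g (nabla g X X) Y q = a0" "\<And>q. riem_inner \<A> g (nabla g Y X) Y q = a1"
  shows "gauss_curvature \<A> g p = - (a0\<^sup>2 + a1\<^sup>2)"
proof -
  define c where "c = chart_at \<A> p"
  have c: "c \<in> \<A>" "p \<in> dom_of c" by (simp_all add: c_def chart_at)
  interpret frame_chart c g X Y by (rule frame_chart [OF c(1)])
  have "metric_in g c p (\<chi> l. riemann g c l 2 1 2 p) (axis 1 1) / det (g c p) = - (a0\<^sup>2 + a1\<^sup>2)"
    using assms riem_inner_nabla [OF c(1)] by (intro curvature_frame c(2)) auto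
  then show ?thesis
    by (simp add: gauss_curvature_def c_def [symmetric])
qed

end

text \<open>For the complex number u + iv of constant modulus, a and b are the first partial
  derivatives of u and v. The hypotheses are the two components of the gradient of the squared
  modulus, with the second partial derivatives eliminated by Cauchy-Riemann.\<close>

lemma cauchy_riemann_constant_norm:
  fixes u v a b :: real
  assumes "u * a + v * b = 0" "u * - b + v * a = 0" "u\<^sup>2 + v\<^sup>2 \<noteq> 0"
  shows "a = 0" "b = 0"
proof -
  have "(u\<^sup>2 + v\<^sup>2) * a = u * (u * a + v * b) + v * (u * - b + v * a)"
    "(u\<^sup>2 + v\<^sup>2) * b = v * (u * a + v * b) - u * (u * - b + v * a)"
    by (simp_all add: algebra_simps power2_eq_square)
  with assms have "(u\<^sup>2 + v\<^sup>2) * a = 0" "(u\<^sup>2 + v\<^sup>2) * b = 0" by simp_all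
  with assms(3) show "a = 0" "b = 0" unfolding mult_eq_0_iff by auto
qed

theorem corollary1:
  fixes \<A> :: "'a::{t2_space,second_countable_topology} chart set"
    and g :: "'a gram"
    and X Y :: "'a vfield"
    and A0 A1 :: "'a \<Rightarrow> real"
    and A :: "'a \<Rightarrow> complex"
    and K :: "'a \<Rightarrow> real"
  assumes connected_M: "connected (UNIV :: 'a set)"
    and oriented_M: "oriented_surface \<A>"
    and metric_M: "riemannian_metric \<A> g"
    and riemann_surface_M: "riemann_surface (conformal_charts \<A> g)"
    and K_def: "K = gauss_curvature \<A> g"
    and unit_X: "unit_vector_field \<A> g X"
    and C2_X: "Ck_vector_field 2 \<A> X"
    and frame: "direct_orthonormal_frame \<A> g X Y"
    and A0_def: "A0 = riem_inner \<A> g (nabla g X X) Y"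
    and A1_def: "A1 = riem_inner \<A> g (nabla g Y X) Y"
    and A_def: "A = (\<lambda>p. of_real (A1 p) + \<i> * of_real (A0 p))"
    and pde: "\<And>z p. z \<in> conformal_charts \<A> g \<Longrightarrow> p \<in> dom_of z \<Longrightarrow>
       2 * (1 + of_real ((cmod (A p))\<^sup>2)) * dbar z A p
         - A p * dbar z (\<lambda>q. of_real ((cmod (A q))\<^sup>2)) p = 0"
    and abs_A_const: "\<exists>r. \<forall>p. cmod (A p) = r"
  shows "\<exists>a k. (\<forall>p. A p = a) \<and> (\<forall>p. K p = k) \<and> k = - (cmod a)\<^sup>2 \<and> k \<le> 0 \<and>
           vol_field \<A> g X = ennreal (sqrt (1 - k)) * vol \<A> g"
proof -
  interpret oriented_frame \<A> g X Y
    by unfold_locales (rule oriented_M metric_M C2_X frame)+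
  obtain r where r: "\<And>p. cmod (A p) = r" using abs_A_const by blast
  have norm_A: "(A1 p)\<^sup>2 + (A0 p)\<^sup>2 = r\<^sup>2" for p
    using r [of p] cmod_power2 [of "A p"] by (simp add: A_def)
  have dbar: "dbar z A p = 0" if "z \<in> conformal_charts \<A> g" "p \<in> dom_of z" for z p
  proof -
    have "dbar z (\<lambda>q. complex_of_real ((cmod (A q))\<^sup>2)) p = 0"
      by (simp add: r dbar_def pd_def comp_def)
    moreover have "2 * (1 + complex_of_real ((cmod (A p))\<^sup>2)) = complex_of_real (2 * (1 + r\<^sup>2))"
      by (simp add: r)
    ultimately have "complex_of_real (2 * (1 + r\<^sup>2)) * dbar z A p = 0"
      using pde [OF that] by (simp only: mult_zero_right diff_zero)
    moreover have "1 + r\<^sup>2 \<noteq> 0"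
      using zero_le_power2 [of r] by linarith
    ultimately show ?thesis
      unfolding mult_eq_0_iff of_real_eq_0_iff by simp
  qed
  have dA: "pd z i A0 p = 0 \<and> pd z i A1 p = 0"
    if z: "z \<in> conformal_charts \<A> g" "p \<in> dom_of z" and "r \<noteq> 0" for z p i
  proof -
    have "z \<in> \<A>" using z by (simp add: conformal_charts_def)
    interpret frame_chart z g X Y by (rule frame_chart [OF \<open>z \<in> \<A>\<close>])
    note C1 = C1_riem_inner_nabla [OF \<open>z \<in> \<A>\<close>, folded A0_def A1_def]
    have of_real: "bounded_linear complex_of_real" "bounded_linear (\<lambda>x. \<i> * complex_of_real x)"
      by (auto intro: bounded_linear_of_real bounded_linear_const_mult)
    have "pd z i A p = complex_of_real (pd z i A1 p) + \<i> * complex_of_real (pd z i A0 p)" for i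
      unfolding A_def using C1 z(2)
      by (simp only: pd_add Ck_in_bounded_linear [OF of_real(1)] Ck_in_bounded_linear [OF of_real(2)]
          pd_bounded_linear [OF of_real(1)] pd_bounded_linear [OF of_real(2)])
    then have "complex_of_real (pd z 1 A1 p) + \<i> * complex_of_real (pd z 1 A0 p)
        + \<i> * (complex_of_real (pd z 2 A1 p) + \<i> * complex_of_real (pd z 2 A0 p)) = 0"
      using dbar [OF z] by (simp add: dbar_def)
    \<comment> \<open>The real part of A is \<open>A1\<close> and the imaginary part is
      \<open>A0\<close>.\<close>
    then have cr: "pd z 2 A0 p = pd z 1 A1 p" "pd z 2 A1 p = - pd z 1 A0 p"
      by (simp_all add: complex_eq_iff)
    have "2 * (A1 p * pd z i A1 p + A0 p * pd z i A0 p) = pd z i (\<lambda>q. A1 q * A1 q + A0 q * A0 q) p" for i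
      using C1 z(2) by (simp only: pd_add pd_mult Ck_in_mult) (simp add: algebra_simps)
    also have "\<dots> i = 0" for i
      using norm_A z(2) by (intro pd_const_on) (auto simp: power2_eq_square)
    finally have double: "2 * (A1 p * pd z i A1 p + A0 p * pd z i A0 p) = 0" for i .
    have "A1 p * pd z i A1 p + A0 p * pd z i A0 p = 0" for i
      using double [of i] by (metis mult_eq_0_iff zero_neq_numeral)
    note grad = this [of 1] this [of 2, unfolded cr]
    have "(A1 p)\<^sup>2 + (A0 p)\<^sup>2 \<noteq> 0"
      unfolding norm_A using \<open>r \<noteq> 0\<close> by simp
    from cauchy_riemann_constant_norm [OF grad this] cr have "pd z 1 A0 p = 0" "pd z 1 A1 p = 0"
      "pd z 2 A0 p = 0" "pd z 2 A1 p = 0" by auto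
    with exhaust_2 [of i] show ?thesis by metis
  qed
  \<comment> \<open>For r = 0 both functions vanish by \<open>norm_A\<close>. Otherwise the pair is
    locally constant, and connectedness is applied to it as a single map.\<close>
  have A01_const: "A0 p = A0 q \<and> A1 p = A1 q" for p q
  proof (cases "r = 0")
    case True
    then show ?thesis using norm_A [of p] norm_A [of q] by simp
  next
    case False
    have "eventually (\<lambda>q. (A0 p, A1 p) = (A0 q, A1 q)) (nhds p)" for p
    proof -
      obtain z where z: "z \<in> conformal_charts \<A> g" "p \<in> dom_of z"
        using riemann_surface_M unfolding riemann_surface_def by blast
      then have "z \<in> \<A>" by (simp add: conformal_charts_def)
      interpret frame_chart z g X Y by (rule frame_chart [OF \<open>z \<in> \<A>\<close>])
      note C1 = C1_riem_inner_nabla [OF \<open>z \<in> \<A>\<close>, folded A0_def A1_def]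
      have "\<exists>e>0. \<forall>x\<in>ball (coord z p) e. f (param z x) = f p"
        if "Ck_in z 1 (dom_of z) f" "\<And>q i. q \<in> dom_of z \<Longrightarrow> pd z i f q = 0" for f :: "'a \<Rightarrow> real"
        using Ck_on_1_zero_constant [OF open_image imageI [OF z(2)] that(1) [unfolded Ck_in_def]] that(2) z(2)
        by (fastforce simp: pd_def param_coord)
      from this [OF C1(1)] this [OF C1(2)] dA [OF z(1) _ False]
      obtain e e' where e: "e > 0" "\<And>x. x \<in> ball (coord z p) e \<Longrightarrow> A0 (param z x) = A0 p"
        and e': "e' > 0" "\<And>x. x \<in> ball (coord z p) e' \<Longrightarrow> A1 (param z x) = A1 p" by metis
      \<comment> \<open>The smaller coordinate ball serves both functions and is pulled back to a
        neighbourhood of p on the surface.\<close>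
      have "open (dom_of z \<inter> coord z -` ball (coord z p) (min e e'))"
        using chart by (intro continuous_open_preimage) (auto simp: is_chart_def homeomorphism_def)
      moreover have "p \<in> dom_of z \<inter> coord z -` ball (coord z p) (min e e')"
        using z(2) e e' by simp
      moreover have "(A0 p, A1 p) = (A0 q, A1 q)" if "q \<in> dom_of z \<inter> coord z -` ball (coord z p) (min e e')" for q
        using e(2) [of "coord z q"] e'(2) [of "coord z q"] that by (simp add: param_coord)
      ultimately show ?thesis unfolding eventually_nhds by blast
    qed
    then have "(A0 p, A1 p) = (A0 q, A1 q)"
      by (intro connected_local_const [OF connected_M, of p q "\<lambda>q. (A0 q, A1 q)"])
         (auto intro: eventually_at_filter [THEN iffD2] eventually_mono)
    then show ?thesis by simp
  qed
  fix p0 :: 'a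
  define a where "a = A p0"
  have norm_a: "(cmod a)\<^sup>2 = (A0 p0)\<^sup>2 + (A1 p0)\<^sup>2"
    by (simp add: a_def cmod_power2 A_def)
  have "A p = a" for p
    using A01_const [of p p0] by (simp add: a_def A_def)
  moreover have "K p = - (cmod a)\<^sup>2" for p
    unfolding K_def norm_a using A01_const unfolding A0_def A1_def by (intro gauss_curvature_eq) auto
  moreover have "vol_field \<A> g X = ennreal (sqrt (1 - - (cmod a)\<^sup>2)) * vol \<A> g"
  proof -
    \<comment> \<open>With a constant density the integral is that constant times the total area,
      also when the area is infinite.\<close>
    have "sasaki_density \<A> g X = (\<lambda>p. sqrt (1 + (cmod a)\<^sup>2))"
      unfolding sasaki_density_eq [abs_def] norm_a A0_def [symmetric] A1_def [symmetric]
      using A01_const by (metis (mono_tags, lifting))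
    then show ?thesis
      by (simp add: vol_field_def vol_def)
  qed
  ultimately show ?thesis by (intro exI [of _ a] exI [of _ "- (cmod a)\<^sup>2"]) simp
qed

end
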